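(* Let $G_1=A_5\times\langle a\rangle$, $G_2=S_4$, $G_3=S_4\times\langle a\rangle$ with $|a|=2$, and for $n\ge3$ let $G_4=\langle r_0,r_1,r_2\mid r_0^2=r_1^2=r_2^2=1,\ (r_0r_1)^n=(r_1r_2)^2=(r_0r_2)^2=1\rangle\cong\mathbb Z_2\times D_{2n}$. If $\mathcal M$ is a regular linear hypermap on the sphere, then $\mathcal M$ is isomorphic to one of the following (with $\mathcal M$-sequences): $\mathcal M(G_1;(12)(35)a,(12)(34)a,(13)(24)a)$, $[0;2,5,3;30,12,20;120]$; $\mathcal M(G_1;(12)(35)a,(13)(24)a,(12)(34)a)$, $[0;2,3,5;30,20,12;120]$; $\mathcal M(G_1;(14)(35)a,(12)(45)a,(13)(45)a)$, $[0;3,2,5;20,30,12;120]$; $\mathcal M(G_1;(14)(35)a,(14)(23)a,(13)(45)a)$, $[0;5,2,3;12,30,20;120]$; $\mathcal M(G_2;(13),(12),(34))$, $[0;2,3,3;6,4,4;24]$; $\mathcal M(G_2;(34),(13),(12))$, $[0;3,2,3;4,6,4;24]$; $\mathcal M(G_3;(13),(34),(12)(34)a)$, $[0;2,4,3;12,6,8;48]$; $\mathcal M(G_3;(13),(12)(34)a,(34))$, $[0;2,3,4;12,8,6;48]$; $\mathcal M(G_3;(12)(34)a,(13),(12))$, $[0;3,2,4;8,12,6;48]$; $\mathcal M(G_3;(13)a,(12)a,(13)(24)a)$, $[0;4,2,3;6,12,8;48]$; $\mathcal M(G_4;r_0,r_1,r_2)$ for some $n\ge 3$, $[0;2,2,n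;n,n,2;4n]$.
   Context: $A_5$ and $S_4$ act on $\{1,\dots,5\}$ and $\{1,\dots,4\}$, elements in disjoint cycle notation; $a$ generates the direct factor of order 2; $D_{2n}$ is the dihedral group of order $2n$. For a finite group $G$ and pairwise distinct involutions $r_0,r_1,r_2$ generating $G$, $\mathcal M(G;r_0,r_1,r_2)$ is a regular linear hypermap if (1) $\langle r_1,r_2\rangle\cap\langle r_0,r_2\rangle=\langle r_2\rangle$ and (2) $\langle r_1,r_2\rangle\langle r_0,r_2\rangle\cap\langle r_0,r_2\rangle\langle r_1,r_2\rangle=\langle r_1,r_2\rangle\cup\langle r_0,r_2\rangle$. Flags are elements of $G$, $r_i$ acting by right multiplication; $\mathcal M(G;r_i)\cong\mathcal M(G';s_i)$ means a bijection $\sigma:G\to G'$ with $(xr_i)^\sigma=x^\sigma s_i$ for all $x,i$. $V=|G|/|\langle r_1,r_2\rangle|$, $E=|G|/|\langle r_0,r_2\rangle|$, $F=|G|/|\langle r_0,r_1\rangle|$ count vertices, hyperedges, hyperfaces; the type is $(k,m,n)=(|r_1r_2|,|r_0r_2|,|r_0r_1|)$. It is non-orientable if $G=\langle r_0r_2,r_1r_2\rangle$, orientable otherwise, with genus $g$ given by $V+E+F-|G|/2=2-2g$ (orientable) or $2-g$ (non-orientable); "on the sphere" means orientable of genus $0$. The $\mathcal M$-sequence is $[g;k,m,n;V,E,F;|G|]$. *)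

theory Defs
  imports "HOL-Algebra.Algebra"
begin

section \<open>Regular hypermaps given by three involutions\<close>

text \<open>The tuple \<open>(G, r0, r1, r2)\<close> stands for \<open>\<M>(G; r0, r1, r2)\<close>.\<close>

type_synonym 'a hypermap = "'a monoid \<times> 'a \<times> 'a \<times> 'a"

definition involution :: "'a monoid \<Rightarrow> 'a \<Rightarrow> bool" where
  "involution G x \<longleftrightarrow> x \<in> carrier G \<and> x \<noteq> \<one>\<^bsub>G\<^esub> \<and> x \<otimes>\<^bsub>G\<^esub> x = \<one>\<^bsub>G\<^esub>"

fun regular_hypermap :: "'a hypermap \<Rightarrow> bool" where
  "regular_hypermap (G, r0, r1, r2) \<longleftrightarrow>
     group G \<and> finite (carrier G) \<and>
     involution G r0 \<and> involution G r1 \<and> involution G r2 \<and>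
     distinct [r0, r1, r2] \<and>
     generate G {r0, r1, r2} = carrier G"

text \<open>The subgroups generated by two of the involutions; their left cosets are the
  hypervertices, hyperedges and hyperfaces, respectively.\<close>

fun vertex_stab :: "'a hypermap \<Rightarrow> 'a set" where
  "vertex_stab (G, r0, r1, r2) = generate G {r1, r2}"

fun edge_stab :: "'a hypermap \<Rightarrow> 'a set" where
  "edge_stab (G, r0, r1, r2) = generate G {r0, r2}"

fun face_stab :: "'a hypermap \<Rightarrow> 'a set" where
  "face_stab (G, r0, r1, r2) = generate G {r0, r1}"

fun regular_linear_hypermap :: "'a hypermap \<Rightarrow> bool" where
  "regular_linear_hypermap (G, r0, r1, r2) \<longleftrightarrow>
     regular_hypermap (G, r0, r1, r2) \<and>
     generate G {r1, r2} \<inter> generate G {r0, r2} = generate G {r2} \<and>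
     (generate G {r1, r2} <#>\<^bsub>G\<^esub> generate G {r0, r2}) \<inter>
     (generate G {r0, r2} <#>\<^bsub>G\<^esub> generate G {r1, r2})
       = generate G {r1, r2} \<union> generate G {r0, r2}"

text \<open>An isomorphism is a bijection of the flags, not required to be a group homomorphism.\<close>

fun hypermap_iso :: "'a hypermap \<Rightarrow> 'b hypermap \<Rightarrow> bool" where
  "hypermap_iso (G, r0, r1, r2) (G', s0, s1, s2) \<longleftrightarrow>
     (\<exists>\<sigma>. bij_betw \<sigma> (carrier G) (carrier G') \<and>
        (\<forall>x \<in> carrier G.
           \<sigma> (x \<otimes>\<^bsub>G\<^esub> r0) = \<sigma> x \<otimes>\<^bsub>G'\<^esub> s0 \<and>
           \<sigma> (x \<otimes>\<^bsub>G\<^esub> r1) = \<sigma> x \<otimes>\<^bsub>G'\<^esub> s1 \<and>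
           \<sigma> (x \<otimes>\<^bsub>G\<^esub> r2) = \<sigma> x \<otimes>\<^bsub>G'\<^esub> s2))"

definition flags :: "'a hypermap \<Rightarrow> nat" where
  "flags M = card (carrier (fst M))"

text \<open>The divisions on \<^typ>\<open>nat\<close> are exact by Lagrange's theorem.\<close>

definition num_vertices :: "'a hypermap \<Rightarrow> nat" where
  "num_vertices M = flags M div card (vertex_stab M)"

definition num_edges :: "'a hypermap \<Rightarrow> nat" where
  "num_edges M = flags M div card (edge_stab M)"

definition num_faces :: "'a hypermap \<Rightarrow> nat" where
  "num_faces M = flags M div card (face_stab M)"

fun hypermap_type :: "'a hypermap \<Rightarrow> nat \<times> nat \<times> nat" where
  "hypermap_type (G, r0, r1, r2) =
     (group.ord G (r1 \<otimes>\<^bsub>G\<^esub> r2), group.ord G (r0 \<otimes>\<^bsub>G\<^esub> r2), group.ord G (r0 \<otimes>\<^bsub>G\<^esub> r1))"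

fun orientable :: "'a hypermap \<Rightarrow> bool" where
  "orientable (G, r0, r1, r2) \<longleftrightarrow>
     carrier G \<noteq> generate G {r0 \<otimes>\<^bsub>G\<^esub> r2, r1 \<otimes>\<^bsub>G\<^esub> r2}"

definition euler_characteristic :: "'a hypermap \<Rightarrow> rat" where
  "euler_characteristic M =
     of_nat (num_vertices M) + of_nat (num_edges M) + of_nat (num_faces M)
       - of_nat (flags M) / 2"

text \<open>The solution \<open>g\<close> of \<open>\<chi> = 2 - 2 g\<close> (orientable) or \<open>\<chi> = 2 - g\<close> (non-orientable);
  it is rational-valued so that no rounding takes place.\<close>

definition genus :: "'a hypermap \<Rightarrow> rat" where
  "genus M = (if orientable M then (2 - euler_characteristic M) / 2
              else 2 - euler_characteristic M)"

definition on_sphere :: "'a hypermap \<Rightarrow> bool" where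
  "on_sphere M \<longleftrightarrow> orientable M \<and> genus M = 0"

text \<open>\<open>[g; k, m, n; V, E, F; |G|]\<close>\<close>

type_synonym M_seq = "rat \<times> (nat \<times> nat \<times> nat) \<times> (nat \<times> nat \<times> nat) \<times> nat"

definition M_sequence :: "'a hypermap \<Rightarrow> M_seq" where
  "M_sequence M =
     (genus M, hypermap_type M, (num_vertices M, num_edges M, num_faces M), flags M)"

definition has_M_sequence :: "'a hypermap \<Rightarrow> M_seq \<Rightarrow> bool" where
  "has_M_sequence M s \<longleftrightarrow> regular_hypermap M \<and> M_sequence M = s"


section \<open>Groups given by a presentation\<close>

text \<open>Generators are all elements of the type \<^typ>\<open>'a\<close>; the letter \<open>(x, True)\<close> stands for \<open>x\<close>
  and \<open>(x, False)\<close> for its inverse. Two words are equivalent if they represent the same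
  element of the group with relators \<open>R\<close>.\<close>

type_synonym 'a gword = "('a \<times> bool) list"

inductive word_equiv :: "'a gword set \<Rightarrow> 'a gword \<Rightarrow> 'a gword \<Rightarrow> bool"
  for R :: "'a gword set" where
  refl: "word_equiv R u u"
| sym: "word_equiv R u v \<Longrightarrow> word_equiv R v u"
| trans: "word_equiv R u v \<Longrightarrow> word_equiv R v w \<Longrightarrow> word_equiv R u w"
| cancel: "word_equiv R (u @ [(x, b), (x, \<not> b)] @ v) (u @ v)"
| relator: "r \<in> R \<Longrightarrow> word_equiv R (u @ r @ v) (u @ v)"

definition word_class :: "'a gword set \<Rightarrow> 'a gword \<Rightarrow> 'a gword set" where
  "word_class R u = {v. word_equiv R u v}"

definition presented_group :: "'a gword set \<Rightarrow> 'a gword set monoid" where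
  "presented_group R =
     \<lparr>carrier = range (word_class R),
      monoid.mult = (\<lambda>A B. \<Union>u\<in>A. \<Union>v\<in>B. word_class R (u @ v)),
      one = word_class R []\<rparr>"

definition presented_gen :: "'a gword set \<Rightarrow> 'a \<Rightarrow> 'a gword set" where
  "presented_gen R x = word_class R [(x, True)]"


section \<open>The groups \<open>G\<^sub>1, \<dots>, G\<^sub>4\<close>\<close>

text \<open>The factor of order two is the additive group of integers modulo 2, so its generator
  \<open>a\<close> is \<open>1\<close>: the pair \<open>(p, 1)\<close> is \<open>p a\<close>, and \<open>(p, 0)\<close> is \<open>p\<close>.

  Permutations are multiplied by \<open>p \<otimes> q = p \<circ> q\<close>. If they are made to act from the right
  instead, one gets the opposite group; inversion is an isomorphism onto it that fixes all
  involutions, so the choice affects neither the isomorphism type of a hypermap nor its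
  numerical invariants.\<close>

definition G1 :: "((nat \<Rightarrow> nat) \<times> int) monoid" where
  "G1 = alt_group 5 \<times>\<times> integer_mod_group 2"

definition G2 :: "(nat \<Rightarrow> nat) monoid" where
  "G2 = sym_group 4"

definition G3 :: "((nat \<Rightarrow> nat) \<times> int) monoid" where
  "G3 = sym_group 4 \<times>\<times> integer_mod_group 2"

datatype generator = R0 | R1 | R2

definition G4_relators :: "nat \<Rightarrow> generator gword set" where
  "G4_relators n =
     (let r0 = (R0, True); r1 = (R1, True); r2 = (R2, True) in
      {[r0, r0], [r1, r1], [r2, r2],
       concat (replicate n [r0, r1]),
       concat (replicate 2 [r1, r2]),
       concat (replicate 2 [r0, r2])})"

definition G4 :: "nat \<Rightarrow> generator gword set monoid" where
  "G4 n = presented_group (G4_relators n)"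

definition G4_hypermap :: "nat \<Rightarrow> generator gword set hypermap" where
  "G4_hypermap n =
     (let r = presented_gen (G4_relators n) in (G4 n, r R0, r R1, r R2))"

text \<open>The dihedral group of order \<open>2 n\<close> as the semidirect product of the integers modulo \<open>n\<close>
  with a group of order two acting by negation; \<open>(i, False)\<close> are the rotations and
  \<open>(i, True)\<close> the reflections.\<close>

definition dihedral_group :: "nat \<Rightarrow> (int \<times> bool) monoid" where
  "dihedral_group n =
     \<lparr>carrier = {0..<int n} \<times> UNIV,
      monoid.mult = (\<lambda>(i, s) (j, t). ((if s then i - j else i + j) mod int n, s \<noteq> t)),
      one = (0, False)\<rparr>"

end

theory Submission
  imports Defs
begin

text \<open>
  Linearity forces \<open>|r0 r1| \<ge> 3\<close>: otherwise \<open>r0 r1 = r1 r0\<close> lies in both products of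
  the vertex and edge stabilizers, but in neither stabilizer. On the sphere, Euler's formula reads
  \<open>|G| (1/k + 1/m + 1/n - 1) = 4\<close>, which leaves eleven types and determines \<open>|G|\<close>. Two
  regular hypermaps of the same type with \<open>N\<close> flags are isomorphic as soon as every orbit of
  the triangle group has at most \<open>N\<close> elements: the orbit of \<open>(1, 1)\<close> in the product of the
  two flag sets projects onto both factors, so it is the graph of an isomorphism. The bound on
  the orbits is a coset enumeration.
\<close>

section \<open>Coset enumeration in the spherical triangle groups\<close>

text \<open>Only upper bounds on orbits are computed. The matching lower bound is free, because the
  orbit in the product projects onto a flag set with \<open>N\<close> elements. The bounds are
  therefore stated for arbitrary self-maps of an arbitrary type that satisfy the triangle relations.
  In this form they apply to the product action without a triangle group being constructed, and,
  through right multiplications, they also bound the order of the presented group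
  \<open>G4 n\<close>. The other half of the work is to verify the listed models. Generation is
  shown by counting, not by writing elements as words: a subgroup containing three involutions
  contains the three dihedral subgroups they span in pairs, so its order is divisible by the lcm of
  their orders. Orientability is shown by a homomorphism to the group of order 2 under which every
  generator is odd, so the even subgroup is never computed.\<close>

inductive_set flag_orbit :: "('x \<Rightarrow> 'x) set \<Rightarrow> 'x \<Rightarrow> 'x set" for F :: "('x \<Rightarrow> 'x) set" and x :: 'x where
  base: "x \<in> flag_orbit F x"
| step: "y \<in> flag_orbit F x \<Longrightarrow> f \<in> F \<Longrightarrow> f y \<in> flag_orbit F x"

text \<open>\<open>B o A\<close> is the conjugate of \<open>A o B\<close> by the involution
  \<open>A\<close>. The enumerations below fix the order inside each pair of generators, while
  renaming generators and passing to right multiplication both reverse it.\<close>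

lemma funpow_comp_swap_eq_id:
  fixes A B :: "'x \<Rightarrow> 'x"
  assumes "A \<circ> A = id" "(A \<circ> B) ^^ p = id"
  shows "(B \<circ> A) ^^ p = id"
proof -
  have "A \<circ> (B \<circ> A) ^^ j = (A \<circ> B) ^^ j \<circ> A" for j
  proof (induction j)
    case (Suc j)
    have "A \<circ> (B \<circ> A) ^^ Suc j = (A \<circ> B) \<circ> (A \<circ> (B \<circ> A) ^^ j)"
      by (simp add: o_assoc)
    then show ?case
      by (simp only: Suc funpow.simps(2) o_assoc)
  qed simp
  then have "A \<circ> (A \<circ> (B \<circ> A) ^^ p) = A \<circ> A"
    using assms(2) by simp
  then show ?thesis
    by (metis assms(1) id_comp o_assoc)
qed

lemma orbit_two_involutions:
  fixes A B :: "'x \<Rightarrow> 'x"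
  assumes AA: "A \<circ> A = id" and BB: "B \<circ> B = id" and AB: "(A \<circ> B) ^^ p = id" and p: "p > 0"
  obtains D where "finite D" "card D \<le> 2 * p" "x \<in> D" "A ` D \<subseteq> D" "B ` D \<subseteq> D"
proof -
  define c where "c = (\<lambda>i. ((A \<circ> B) ^^ i) x)"
  have AA': "A (A y) = y" and BB': "B (B y) = y" for y
    using AA BB by (auto simp: fun_eq_iff)
  have per: "c (i + p) = c i" for i
    using AB by (simp add: c_def funpow_add)
  have per_mod: "c (i mod p) = c i" for i
    by (metis AB c_def funpow_mod_eq id_apply)
  have rng: "range c = c ` {..<p}"
    using per_mod p by (metis image_subset_iff lessThan_iff mod_less_divisor rangeI subset_antisym image_eqI)
  \<comment> \<open>\<open>B\<close> acts on the rotation orbit as a rotation followed by the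
    reflection \<open>A\<close>, so it lands in the second half of \<open>D\<close>.\<close>
  have Bc: "B (c i) = A (c (Suc i))" for i
    by (simp add: c_def AA')
  have BA: "B (A (c i)) \<in> range c" for i
  proof -
    \<comment> \<open>Shifting by the period gives \<open>c i\<close> a predecessor even for
      \<open>i = 0\<close>.\<close>
    obtain j where "i + p = Suc j"
      using p by (metis add_gr_0 gr0_implies_Suc)
    then have "c i = A (B (c j))"
      by (metis per c_def funpow.simps(2) comp_apply)
    then show ?thesis
      by (simp add: AA' BB')
  qed
  define D where "D = range c \<union> A ` range c"
  have "finite D"
    unfolding D_def rng by simp
  moreover have "card D \<le> 2 * p"
  proof -
    have "card (c ` {..<p}) \<le> p"
      by (metis card_image_le card_lessThan finite_lessThan)
    moreover have "card (A ` c ` {..<p}) \<le> p"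
      by (metis calculation card_image_le finite_imageI finite_lessThan order_trans)
    ultimately show ?thesis
      unfolding D_def rng by (metis add_mono card_Un_le mult_2 order_trans)
  qed
  moreover have "x \<in> D"
    unfolding D_def c_def by (metis UnI1 funpow_0 rangeI)
  moreover have "A ` D \<subseteq> D" "B ` D \<subseteq> D"
    using BA by (auto simp: D_def AA' Bc)
  ultimately show thesis
    using that by blast
qed

text \<open>Coset enumeration: the functions in \<open>W\<close> represent the left cosets of the dihedral
  group generated by \<open>A\<close> and \<open>B\<close>.\<close>

lemma card_orbit_le:
  fixes A B C :: "'x \<Rightarrow> 'x"
  assumes inv: "A \<circ> A = id" "B \<circ> B = id" and AB: "(A \<circ> B) ^^ p = id" "p > 0"
    and W: "id \<in> set W"
    and closed: "\<forall>w\<in>set W. \<forall>f\<in>{A, B, C}.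
      \<exists>w'\<in>set W. \<exists>t\<in>{id, A, B}. f \<circ> w = w' \<circ> t"
  shows "finite (flag_orbit {A, B, C} x) \<and> card (flag_orbit {A, B, C} x) \<le> length W * (2 * p)"
proof -
  obtain D where D: "finite D" "card D \<le> 2 * p" "x \<in> D" "A ` D \<subseteq> D" "B ` D \<subseteq> D"
    using orbit_two_involutions[OF inv AB] by metis
  define S where "S = (\<lambda>(w, y). w y) ` (set W \<times> D)"
  have sub: "y \<in> S" if "y \<in> flag_orbit {A, B, C} x" for y
    using that
  proof induction
    case base
    show ?case
      using W D(3) unfolding S_def by (intro image_eqI[of _ _ "(id, x)"]) auto
  next
    case (step y f)
    then obtain w d where wd: "w \<in> set W" "d \<in> D" "y = w d"
      unfolding S_def by auto
    obtain w' t where w't: "w' \<in> set W" "t \<in> {id, A, B}" "f \<circ> w = w' \<circ> t"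
      using closed wd(1) step(2) by meson
    have "t d \<in> D"
      using w't(2) wd(2) D(4,5) by auto
    moreover have "f y = w' (t d)"
      using w't(3) wd(3) by (metis comp_apply)
    ultimately show ?case
      using w't(1) unfolding S_def by (intro image_eqI[of _ _ "(w', t d)"]) auto
  qed
  have "finite S"
    unfolding S_def using D(1) by simp
  moreover have "card S \<le> length W * (2 * p)"
  proof -
    have "card S \<le> card (set W \<times> D)"
      unfolding S_def using D(1) by (intro card_image_le) simp
    also have "\<dots> \<le> length W * (2 * p)"
      unfolding card_cartesian_product by (intro mult_mono card_length D(2)) auto
    finally show ?thesis .
  qed
  ultimately show ?thesis
    using sub by (meson card_mono finite_subset order_trans subsetI)
qed

text \<open>\<open>C\<close> commutes with \<open>A\<close> and \<open>B\<close>, so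
  \<open>id\<close> and \<open>C\<close> represent all cosets of the dihedral group.\<close>

lemma card_orbit_22n:
  fixes A B C :: "'x \<Rightarrow> 'x"
  assumes inv: "A \<circ> A = id" "B \<circ> B = id" "C \<circ> C = id"
    and rel: "(A \<circ> B) ^^ n = id" "(B \<circ> C) ^^ 2 = id" "(A \<circ> C) ^^ 2 = id" and n: "n > 0"
  shows "finite (flag_orbit {A, B, C} x) \<and> card (flag_orbit {A, B, C} x) \<le> 4 * n"
proof -
  have inv': "A (A y) = y" "B (B y) = y" "C (C y) = y" for y
    using inv by (auto simp: fun_eq_iff)
  have *: "A (C y) = C (A y)" "B (C y) = C (B y)" for y
    using rel(2,3)
     apply (auto simp: fun_eq_iff numeral_2_eq_2)
     apply (metis inv')+
    done
  have closed: "\<forall>w\<in>set [id, C]. \<forall>f\<in>{A, B, C}. \<exists>w'\<in>set [id, C]. \<exists>t\<in>{id, A, B}. f \<circ> w = w' \<circ> t"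
    by (auto simp: fun_eq_iff * inv')
  show ?thesis
    using card_orbit_le[OF inv(1,2) rel(1) n _ closed, of x] by simp
qed

text \<open>Four cosets of a dihedral group of order 6, as for the four vertices of the tetrahedron.
  The relations are oriented into rewrite rules on words in \<open>A\<close>, \<open>B\<close>,
  \<open>C\<close>, and an entry of the coset table is proved by normalising both sides.\<close>

lemma card_orbit_233:
  fixes A B C :: "'x \<Rightarrow> 'x"
  assumes inv: "A \<circ> A = id" "B \<circ> B = id" "C \<circ> C = id"
    and rel: "(A \<circ> B) ^^ 3 = id" "(B \<circ> C) ^^ 3 = id" "(A \<circ> C) ^^ 2 = id"
  shows "finite (flag_orbit {A, B, C} x) \<and> card (flag_orbit {A, B, C} x) \<le> 24"
proof -
  have inv': "A (A y) = y" "B (B y) = y" "C (C y) = y" for y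
    using inv by (auto simp: fun_eq_iff)
  have rel': "A (B (A (B (A (B y))))) = y" "B (C (B (C (B (C y))))) = y" "A (C (A (C y))) = y" for y
    using rel by (auto simp: fun_eq_iff eval_nat_numeral)
  have AC: "C (A y) = A (C y)" for y
    using rel'(3)[of "C (A y)"] by (simp add: inv')
  have BAB: "B (A (B y)) = A (B (A y))" for y
    using rel'(1)[of "B (A (B y))"] by (simp add: inv')
  have CBC: "C (B (C y)) = B (C (B y))" for y
    using rel'(2)[of "C (B (C y))"] by (simp add: inv')
  \<comment> \<open>Critical pair: the word C B C A can be rewritten by \<open>CBC\<close> or by
    \<open>AC\<close>.\<close>
  have CBAC: "C (B (A (C y))) = B (C (B (A y)))" for y
    using CBC[of "A y"] by (simp add: AC)
  note rules = inv' AC BAB CBC CBAC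
  define w2 where "w2 = B \<circ> C"
  define w3 where "w3 = A \<circ> w2"
  note w_defs = w2_def w3_def
  \<comment> \<open>One row per representative, one column for each of \<open>A\<close>,
    \<open>B\<close>, \<open>C\<close>; the row of \<open>id\<close> is immediate. If the same
    representative stands on both sides, the generator fixes its coset and comes out on the right as
    an element of the dihedral group.\<close>
  have table:
    "A \<circ> C = C \<circ> A" "B \<circ> C = w2" "C \<circ> C = id"
    "A \<circ> w2 = w3" "B \<circ> w2 = C" "C \<circ> w2 = w2 \<circ> B"
    "A \<circ> w3 = w2" "B \<circ> w3 = w3 \<circ> A" "C \<circ> w3 = w3 \<circ> B"
    by (simp_all add: w_defs fun_eq_iff rules)
  let ?W = "[id, C, w2, w3]"
  have closed: "\<forall>w\<in>set ?W. \<forall>f\<in>{A, B, C}. \<exists>w'\<in>set ?W. \<exists>t\<in>{id, A, B}. f \<circ> w = w' \<circ> t"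
    by (simp add: table)
  show ?thesis
    using card_orbit_le[OF inv(1,2) rel(1) _ _ closed, of x] by simp
qed

text \<open>Six cosets of a dihedral group of order 8, as for the six vertices of the octahedron.
  The rules now point the other way for the pairs \<open>A\<close>, \<open>C\<close> and
  \<open>B\<close>, \<open>C\<close>: A C becomes C A, and B C B becomes C B C.\<close>

lemma card_orbit_234:
  fixes A B C :: "'x \<Rightarrow> 'x"
  assumes inv: "A \<circ> A = id" "B \<circ> B = id" "C \<circ> C = id"
    and rel: "(A \<circ> B) ^^ 4 = id" "(B \<circ> C) ^^ 3 = id" "(A \<circ> C) ^^ 2 = id"
  shows "finite (flag_orbit {A, B, C} x) \<and> card (flag_orbit {A, B, C} x) \<le> 48"
proof -
  have inv': "A (A y) = y" "B (B y) = y" "C (C y) = y" for y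
    using inv by (auto simp: fun_eq_iff)
  have rel': "A (B (A (B (A (B (A (B y))))))) = y" "B (C (B (C (B (C y))))) = y" "A (C (A (C y))) = y" for y
    using rel by (auto simp: fun_eq_iff eval_nat_numeral)
  have AC: "A (C y) = C (A y)" for y
    using rel'(3)[of "C (A y)"] by (simp add: inv')
  have ABAB: "A (B (A (B y))) = B (A (B (A y)))" for y
    using rel'(1)[of "B (A (B (A y)))"] by (simp add: inv')
  have BCB: "B (C (B y)) = C (B (C y))" for y
    using rel'(2)[of "C (B (C y))"] by (metis inv')
  \<comment> \<open>Critical pair of \<open>ABAB\<close> and \<open>BCB\<close>, from the word A B A
    B C B.\<close>
  have ABCABC: "A (B (C (A (B (C y))))) = B (A (B (C (A (B y)))))" for y
    using ABAB[of "C (B y)"] by (metis AC BCB)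
  note rules = inv' AC ABAB BCB ABCABC
  define w2 where "w2 = B \<circ> C"
  define w3 where "w3 = A \<circ> w2"
  define w4 where "w4 = B \<circ> w3"
  define w5 where "w5 = C \<circ> w4"
  note w_defs = w2_def w3_def w4_def w5_def
  have table:
    "A \<circ> C = C \<circ> A" "B \<circ> C = w2" "C \<circ> C = id"
    "A \<circ> w2 = w3" "B \<circ> w2 = C" "C \<circ> w2 = w2 \<circ> B"
    "A \<circ> w3 = w2" "B \<circ> w3 = w4" "C \<circ> w3 = w3 \<circ> B"
    "A \<circ> w4 = w4 \<circ> A" "B \<circ> w4 = w3" "C \<circ> w4 = w5"
    "A \<circ> w5 = w5 \<circ> A" "B \<circ> w5 = w5 \<circ> B" "C \<circ> w5 = w4"
    by (simp_all add: w_defs fun_eq_iff rules)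
  let ?W = "[id, C, w2, w3, w4, w5]"
  have closed: "\<forall>w\<in>set ?W. \<forall>f\<in>{A, B, C}. \<exists>w'\<in>set ?W. \<exists>t\<in>{id, A, B}. f \<circ> w = w' \<circ> t"
    by (simp add: table)
  show ?thesis
    using card_orbit_le[OF inv(1,2) rel(1) _ _ closed, of x] by simp
qed

text \<open>Twelve cosets of a dihedral group of order 10, as for the twelve vertices of the
  icosahedron. The definitions of \<open>w2\<close> to \<open>w11\<close> trace a spanning tree of
  the coset graph: each applies one generator to an earlier representative.\<close>

lemma card_orbit_235:
  fixes A B C :: "'x \<Rightarrow> 'x"
  assumes inv: "A \<circ> A = id" "B \<circ> B = id" "C \<circ> C = id"
    and rel: "(A \<circ> B) ^^ 5 = id" "(B \<circ> C) ^^ 3 = id" "(A \<circ> C) ^^ 2 = id"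
  shows "finite (flag_orbit {A, B, C} x) \<and> card (flag_orbit {A, B, C} x) \<le> 120"
proof -
  have inv': "A (A y) = y" "B (B y) = y" "C (C y) = y" for y
    using inv by (auto simp: fun_eq_iff)
  have rel': "A (B (A (B (A (B (A (B (A (B y))))))))) = y" "B (C (B (C (B (C y))))) = y" "A (C (A (C y))) = y" for y
    using rel by (auto simp: fun_eq_iff eval_nat_numeral)
  have AC: "C (A y) = A (C y)" for y
    using rel'(3)[of "C (A y)"] by (simp add: inv')
  have BABAB: "B (A (B (A (B y)))) = A (B (A (B (A y))))" for y
    using rel'(1)[of "B (A (B (A (B y))))"] by (simp add: inv')
  have CBC: "C (B (C y)) = B (C (B y))" for y
    using rel'(2)[of "C (B (C y))"] by (simp add: inv')
  have CBAC: "C (B (A (C y))) = B (C (B (A y)))" for y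
    using CBC[of "A y"] by (simp add: AC)
  have CBABCB: "C (B (A (B (C (B y))))) = B (C (B (A (B (C y)))))" for y
    using CBAC[of "B (C y)"] by (simp add: CBC)
  \<comment> \<open>from the overlap of the rules \<open>CBABCB\<close> and \<open>BABAB\<close>; it makes the rules confluent\<close>
  have *: "C (B (A (B (A (C (B (A (B (A y))))))))) = B (C (B (A (B (A (C (B (A (B y)))))))))" for y
    using CBABCB[of "A (B (A (B y)))"] by (simp add: BABAB AC)
  note rules = inv' AC BABAB CBC CBAC CBABCB *
  define w2 where "w2 = B \<circ> C"
  define w3 where "w3 = A \<circ> w2"
  define w4 where "w4 = B \<circ> w3"
  define w5 where "w5 = C \<circ> w4"
  define w6 where "w6 = A \<circ> w4"
  define w7 where "w7 = A \<circ> w5"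
  define w8 where "w8 = B \<circ> w7"
  define w9 where "w9 = A \<circ> w8"
  define w10 where "w10 = B \<circ> w9"
  define w11 where "w11 = C \<circ> w10"
  note w_defs = w2_def w3_def w4_def w5_def w6_def w7_def w8_def w9_def w10_def w11_def
  have table:
    "A \<circ> C = C \<circ> A" "B \<circ> C = w2" "C \<circ> C = id"
    "A \<circ> w2 = w3" "B \<circ> w2 = C" "C \<circ> w2 = w2 \<circ> B"
    "A \<circ> w3 = w2" "B \<circ> w3 = w4" "C \<circ> w3 = w3 \<circ> B"
    "A \<circ> w4 = w6" "B \<circ> w4 = w3" "C \<circ> w4 = w5"
    "A \<circ> w5 = w7" "B \<circ> w5 = w5 \<circ> B" "C \<circ> w5 = w4"
    "A \<circ> w6 = w4" "B \<circ> w6 = w6 \<circ> A" "C \<circ> w6 = w7"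
    "A \<circ> w7 = w5" "B \<circ> w7 = w8" "C \<circ> w7 = w6"
    "A \<circ> w8 = w9" "B \<circ> w8 = w7" "C \<circ> w8 = w8 \<circ> A"
    "A \<circ> w9 = w8" "B \<circ> w9 = w10" "C \<circ> w9 = w9 \<circ> A"
    "A \<circ> w10 = w10 \<circ> B" "B \<circ> w10 = w9" "C \<circ> w10 = w11"
    "A \<circ> w11 = w11 \<circ> B" "B \<circ> w11 = w11 \<circ> A" "C \<circ> w11 = w10"
    by (simp_all add: w_defs fun_eq_iff rules)
  let ?W = "[id, C, w2, w3, w4, w5, w6, w7, w8, w9, w10, w11]"
  have closed: "\<forall>w\<in>set ?W. \<forall>f\<in>{A, B, C}. \<exists>w'\<in>set ?W. \<exists>t\<in>{id, A, B}. f \<circ> w = w' \<circ> t"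
    by (simp add: table)
  show ?thesis
    using card_orbit_le[OF inv(1,2) rel(1) _ _ closed, of x] by simp
qed

section \<open>Counting cells and the eleven spherical types\<close>

text \<open>\<open>Y\<close> need not be a subgroup. The induction proves the stronger claim that
  \<open>Y\<close> is stable under right multiplication by every generated element, which survives
  products; inverses are harmless because each generator is its own inverse.\<close>

lemma (in group) generate_involutions_subset:
  assumes SG: "S \<subseteq> carrier G" and S: "\<And>s. s \<in> S \<Longrightarrow> s \<otimes> s = \<one>"
    and Y: "Y \<subseteq> carrier G" "\<one> \<in> Y" "\<And>x s. x \<in> Y \<Longrightarrow> s \<in> S \<Longrightarrow> x \<otimes> s \<in> Y"
  shows "generate G S \<subseteq> Y"
proof -
  have "\<forall>x\<in>Y. x \<otimes> g \<in> Y" if "g \<in> generate G S" for g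
    using that
  proof induction
    case one
    then show ?case using Y(1) by auto
  next
    case (incl h)
    then show ?case using Y(3) by auto
  next
    case (inv h)
    have "inv h = h"
      using S[OF inv] SG inv by (auto intro: inv_equality)
    then show ?case using Y(3) inv by auto
  next
    case (eng g h)
    have "g \<in> carrier G" "h \<in> carrier G"
      using eng generate_incl[OF SG] by auto
    then show ?case
      using eng.IH Y(1) by (metis m_assoc subsetD)
  qed
  then show ?thesis
    using Y(2) generate_incl[OF SG] by (metis l_one subsetI subsetD)
qed

text \<open>The dihedral decomposition: the rotations are the powers of \<open>a b\<close>, the
  reflections form their coset by \<open>a\<close>, and conjugation by \<open>a\<close> inverts
  rotations.\<close>

lemma (in group) generate_two_involutions:
  assumes fin: "finite (carrier G)" and a: "a \<in> carrier G" "a \<otimes> a = \<one>" and b: "b \<in> carrier G" "b \<otimes> b = \<one>"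
  shows "generate G {a, b} = generate G {a \<otimes> b} \<union> (\<lambda>x. a \<otimes> x) ` generate G {a \<otimes> b}"
    and "x \<in> generate G {a \<otimes> b} \<Longrightarrow> a \<otimes> x \<otimes> a = inv x"
proof -
  note [simp] = a(1) b(1)
  note aa = a(2) and bb = b(2)
  have aa': "a \<otimes> (a \<otimes> y) = y" and bb': "b \<otimes> (b \<otimes> y) = y" if "y \<in> carrier G" for y
    using that aa bb by (simp_all flip: m_assoc)
  have inv_ab: "inv (a \<otimes> b) = b \<otimes> a"
    by (rule inv_equality) (simp_all add: m_assoc aa' bb' aa bb)
  let ?C = "generate G {a \<otimes> b}"
  have sub: "subgroup ?C G"
    by (rule generate_is_subgroup) simp
  have CG: "x \<in> carrier G" if "x \<in> ?C" for x
    by (rule subgroup.mem_carrier[OF sub that])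
  show conj: "a \<otimes> x \<otimes> a = inv x" if "x \<in> ?C" for x
    using that
  proof induction
    case one
    then show ?case by (simp add: aa)
  next
    case (incl h)
    then show ?case by (simp add: inv_ab m_assoc[symmetric] aa)
  next
    case (inv h)
    then have "inv (inv h) = a \<otimes> b" "inv h = b \<otimes> a"
      by (simp_all add: inv_ab[symmetric] del: inv_mult_group)
    then show ?case by (simp add: m_assoc aa)
  next
    case (eng g h)
    have gh: "g \<in> carrier G" "h \<in> carrier G"
      using eng CG by auto
    \<comment> \<open>Inversion reverses products, so the inductive step needs that the rotation
      subgroup is cyclic, hence commutative.\<close>
    have comm: "g \<otimes> h = h \<otimes> g"
      using eng(1,2) gh unfolding generate_pow_on_finite_carrier[OF fin, of "a \<otimes> b", simplified]
      by (auto simp: nat_pow_mult add.commute)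
    have "a \<otimes> (g \<otimes> h) \<otimes> a = (a \<otimes> g \<otimes> a) \<otimes> (a \<otimes> h \<otimes> a)"
      using gh by (simp add: m_assoc aa')
    also have "\<dots> = inv (g \<otimes> h)"
      using gh eng by (simp add: comm inv_mult_group)
    finally show ?case .
  qed
  have abC: "a \<otimes> b \<in> ?C"
    by (simp add: generate.incl)
  have Ca: "x \<otimes> a = a \<otimes> inv x" if "x \<in> ?C" for x
    using conj[OF that] CG[OF that] by (metis \<open>a \<in> carrier G\<close> aa' m_closed m_assoc)
  have C_inv: "inv x \<in> ?C" if "x \<in> ?C" for x
    using sub that by (simp add: subgroup.m_inv_closed)
  have b_eq: "b = a \<otimes> (a \<otimes> b)"
    by (simp add: aa')
  show "generate G {a, b} = ?C \<union> (\<lambda>x. a \<otimes> x) ` ?C"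
  proof (rule subset_antisym)
    show "generate G {a, b} \<subseteq> ?C \<union> (\<lambda>x. a \<otimes> x) ` ?C"
    proof (rule generate_involutions_subset)
      show "?C \<union> (\<lambda>x. a \<otimes> x) ` ?C \<subseteq> carrier G"
        using CG by auto
      show "\<one> \<in> ?C \<union> (\<lambda>x. a \<otimes> x) ` ?C"
        by (simp add: generate.one)
      fix x s assume x: "x \<in> ?C \<union> (\<lambda>x. a \<otimes> x) ` ?C" and s: "s \<in> {a, b}"
      have a_closed: "y \<otimes> a \<in> ?C \<union> (\<lambda>x. a \<otimes> x) ` ?C" if y: "y \<in> ?C \<union> (\<lambda>x. a \<otimes> x) ` ?C" for y
        using y
      proof
        assume "y \<in> ?C"
        then show ?thesis using Ca C_inv by auto
      next
        assume "y \<in> (\<lambda>x. a \<otimes> x) ` ?C"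
        then obtain z where z: "z \<in> ?C" "y = a \<otimes> z" by auto
        then have "y \<otimes> a = inv z"
          using conj by simp
        then show ?thesis using z C_inv by auto
      qed
      \<comment> \<open>Right multiplication by \<open>b\<close> is right multiplication by
        \<open>a\<close> and then by the rotation \<open>a b\<close>, so these two closures
        suffice.\<close>
      have "y \<otimes> (a \<otimes> b) \<in> ?C \<union> (\<lambda>x. a \<otimes> x) ` ?C" if y: "y \<in> ?C \<union> (\<lambda>x. a \<otimes> x) ` ?C" for y
        using y
      proof
        assume "y \<in> ?C"
        then show ?thesis using abC by (blast intro: generate.eng)
      next
        assume "y \<in> (\<lambda>x. a \<otimes> x) ` ?C"
        then obtain z where z: "z \<in> ?C" "y = a \<otimes> z" by auto
        then have "y \<otimes> (a \<otimes> b) = a \<otimes> (z \<otimes> (a \<otimes> b))"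
          using CG by (simp add: m_assoc)
        then show ?thesis using z abC by (blast intro: generate.eng)
      qed
      moreover have "x \<otimes> b = (x \<otimes> a) \<otimes> (a \<otimes> b)"
        using x CG by (auto simp: m_assoc aa')
      ultimately have "x \<otimes> b \<in> ?C \<union> (\<lambda>x. a \<otimes> x) ` ?C"
        using a_closed[OF x] by simp
      then show "x \<otimes> s \<in> ?C \<union> (\<lambda>x. a \<otimes> x) ` ?C"
        using s a_closed[OF x] by auto
    qed (use a b in auto)
  next
    have "?C \<subseteq> generate G {a, b}"
      by (rule generate_subgroup_incl) (auto intro!: generate_is_subgroup intro: generate.eng generate.incl)
    then show "?C \<union> (\<lambda>x. a \<otimes> x) ` ?C \<subseteq> generate G {a, b}"
      by (auto intro: generate.eng generate.incl)
  qed
qed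

text \<open>The rotations and the reflections are disjoint because \<open>a\<close> is not a
  rotation. If it were a power of \<open>a b\<close>, it would commute with \<open>a b\<close>, so
  \<open>a b\<close> would square to the identity; then \<open>a\<close> would be the identity or
  \<open>a b\<close>, forcing \<open>a\<close> or \<open>b\<close> to be trivial.\<close>

lemma (in group) card_generate_two_involutions:
  assumes fin: "finite (carrier G)" and a: "a \<in> carrier G" "a \<otimes> a = \<one>" and b: "b \<in> carrier G" "b \<otimes> b = \<one>"
    and ne: "a \<noteq> \<one>" "b \<noteq> \<one>" "a \<noteq> b"
  shows "card (generate G {a, b}) = 2 * ord (a \<otimes> b)"
proof -
  note [simp] = a(1) b(1)
  note aa = a(2) and a1 = ne(1) and b1 = ne(2)
  let ?C = "generate G {a \<otimes> b}"
  have CG: "?C \<subseteq> carrier G"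
    by (rule generate_incl) simp
  have finC: "finite ?C"
    using CG fin finite_subset by blast
  have a_notin: "a \<notin> ?C"
  proof
    assume aC: "a \<in> ?C"
    have abC: "a \<otimes> b \<in> ?C"
      by (simp add: generate.incl)
    obtain j :: nat where j: "a = (a \<otimes> b) [^] j"
      using aC unfolding generate_pow_on_finite_carrier[OF fin, of "a \<otimes> b", simplified] by auto
    have "a \<otimes> (a \<otimes> b) = (a \<otimes> b) \<otimes> a"
      by (metis j a(1) b(1) m_closed nat_pow_Suc nat_pow_Suc2)
    then have comm: "b = a \<otimes> b \<otimes> a"
      using aa by (metis \<open>a \<in> carrier G\<close> \<open>b \<in> carrier G\<close> l_one m_assoc)
    have sq: "(a \<otimes> b) [^] (2::nat) = \<one>"
    proof -
      have "(a \<otimes> b) [^] (2::nat) = (a \<otimes> b \<otimes> a) \<otimes> b"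
        by (simp add: numeral_2_eq_2 m_assoc)
      also have "\<dots> = \<one>"
        using b comm by simp
      finally show ?thesis .
    qed
    have "j mod 2 = 0 \<or> j mod 2 = 1"
      by auto
    moreover have "(a \<otimes> b) [^] j = (a \<otimes> b) [^] (j mod 2)"
    proof -
      have "(a \<otimes> b) [^] j = ((a \<otimes> b) [^] (2::nat)) [^] (j div 2) \<otimes> (a \<otimes> b) [^] (j mod 2)"
        by (simp add: nat_pow_pow nat_pow_mult)
      then show ?thesis by (simp add: sq)
    qed
    ultimately have "a = \<one> \<or> a = a \<otimes> b"
      using j by auto
    then show False
      using a1 b1 a(1) b(1) by auto
  qed
  have "?C \<inter> (\<lambda>x. a \<otimes> x) ` ?C = {}"
  proof (rule ccontr)
    assume "?C \<inter> (\<lambda>x. a \<otimes> x) ` ?C \<noteq> {}"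
    then obtain x where x: "x \<in> ?C" "a \<otimes> x \<in> ?C" by auto
    have "inv x \<in> ?C"
      using x(1) by (simp add: generate_m_inv_closed)
    then have "a \<otimes> x \<otimes> inv x \<in> ?C"
      using x(2) by (rule generate.eng[rotated])
    then show False
      using a_notin x CG by (auto simp: m_assoc subset_eq)
  qed
  moreover have "card ((\<lambda>x. a \<otimes> x) ` ?C) = card ?C"
    using CG by (intro card_image inj_onI) (metis a(1) l_cancel subsetD)
  ultimately show ?thesis
    unfolding generate_two_involutions(1)[OF fin a b]
    using finC by (simp add: card_Un_disjoint generate_pow_card)
qed

lemma (in group) card_generate_dvd:
  assumes "subgroup H G" "S \<subseteq> H"
  shows "card (generate G S) dvd card H"
proof -
  interpret H: group "G\<lparr>carrier := H\<rparr>"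
    using assms(1) by (rule subgroup_imp_group)
  have "subgroup (generate (G\<lparr>carrier := H\<rparr>) S) (G\<lparr>carrier := H\<rparr>)"
    by (rule H.generate_is_subgroup) (use assms in auto)
  from H.lagrange[OF this] have "card (rcosets\<^bsub>G\<lparr>carrier := H\<rparr>\<^esub> generate G S) * card (generate G S) = card H"
    by (simp add: generate_consistent[OF assms(2,1)] order_def)
  then show ?thesis
    by (metis dvd_triv_right)
qed

section \<open>Cell counts, orientability and Euler's formula\<close>

text \<open>The stabilizers are dihedral of orders \<open>2 * k\<close>, \<open>2 * m\<close>,
  \<open>2 * n\<close>. Stating the counts as products removes \<open>div\<close> from all later
  arithmetic; Lagrange makes the divisions exact.\<close>

lemma regular_hypermap_counts:
  assumes reg: "regular_hypermap (G, r0, r1, r2)" and type: "hypermap_type (G, r0, r1, r2) = (k, m, n)"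
  shows "num_vertices (G, r0, r1, r2) * (2 * k) = flags (G, r0, r1, r2)"
    and "num_edges (G, r0, r1, r2) * (2 * m) = flags (G, r0, r1, r2)"
    and "num_faces (G, r0, r1, r2) * (2 * n) = flags (G, r0, r1, r2)"
proof -
  interpret group G using reg by simp
  have fin: "finite (carrier G)" and inv: "involution G r0" "involution G r1" "involution G r2"
    and ne: "r0 \<noteq> r1" "r0 \<noteq> r2" "r1 \<noteq> r2" using reg by auto
  have C: "r0 \<in> carrier G" "r1 \<in> carrier G" "r2 \<in> carrier G"
    using inv by (auto simp: involution_def)
  have cards: "card (generate G {r1, r2}) = 2 * k" "card (generate G {r0, r2}) = 2 * m"
     "card (generate G {r0, r1}) = 2 * n"
    using type card_generate_two_involutions[OF fin] inv ne by (auto simp: involution_def)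
  have *: "card H dvd card (carrier G)" if "subgroup H G" for H
    using lagrange[OF that] by (metis dvd_triv_right order_def)
  have "card (generate G S) dvd card (carrier G)" if "S \<subseteq> {r0, r1, r2}" for S
    using C that by (intro * generate_is_subgroup) auto
  from this[of "{r1, r2}"] this[of "{r0, r2}"] this[of "{r0, r1}"]
  have "2 * k dvd card (carrier G)" "2 * m dvd card (carrier G)" "2 * n dvd card (carrier G)"
    unfolding cards by auto
  then show "num_vertices (G, r0, r1, r2) * (2 * k) = flags (G, r0, r1, r2)"
    and "num_edges (G, r0, r1, r2) * (2 * m) = flags (G, r0, r1, r2)"
    and "num_faces (G, r0, r1, r2) * (2 * n) = flags (G, r0, r1, r2)"
    by (simp_all add: num_vertices_def num_edges_def num_faces_def flags_def cards)
qed

text \<open>\<open>\<phi>\<close> is a homomorphism to the group of order 2, written with exclusive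
  or. The two generators of the even subgroup lie in its kernel and \<open>r0\<close> does not, so
  that subgroup is proper.\<close>

lemma orientable_if_parity:
  assumes reg: "regular_hypermap (G, r0, r1, r2)"
    and hom: "\<And>x y. x \<in> carrier G \<Longrightarrow> y \<in> carrier G \<Longrightarrow> \<phi> (x \<otimes>\<^bsub>G\<^esub> y) \<longleftrightarrow> \<phi> x \<noteq> \<phi> y"
    and odd: "\<phi> r0" "\<phi> r1" "\<phi> r2"
  shows "orientable (G, r0, r1, r2)"
proof -
  interpret group G using reg by simp
  have C: "r0 \<in> carrier G" "r1 \<in> carrier G" "r2 \<in> carrier G"
    using reg by (auto simp: involution_def)
  let ?S = "{r0 \<otimes>\<^bsub>G\<^esub> r2, r1 \<otimes>\<^bsub>G\<^esub> r2}"
  have S: "?S \<subseteq> carrier G" using C by auto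
  have one: "\<not> \<phi> \<one>\<^bsub>G\<^esub>" using hom[of "\<one>\<^bsub>G\<^esub>" "\<one>\<^bsub>G\<^esub>"] by auto
  have "\<not> \<phi> g" if "g \<in> generate G ?S" for g
    using that
  proof induction
    case one
    then show ?case by fact
  next
    case (incl h)
    then show ?case using C hom odd by auto
  next
    case (inv h)
    then have "h \<in> carrier G" "\<not> \<phi> h" using S C hom odd by auto
    then show ?case using hom[of h "inv\<^bsub>G\<^esub> h"] one by simp
  next
    case (eng g h)
    then show ?case using hom generate_incl[OF S] by auto
  qed
  then show ?thesis using odd(1) C(1) by auto
qed

text \<open>The last equation in \<open>VEF\<close> is Euler characteristic 2, doubled so that it
  lives in the natural numbers.\<close>

lemma has_M_sequence_sphereI:
  assumes reg: "regular_hypermap (G, r0, r1, r2)"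
    and type: "hypermap_type (G, r0, r1, r2) = (k, m, n)"
    and card: "card (carrier G) = N"
    and hom: "\<And>x y. x \<in> carrier G \<Longrightarrow> y \<in> carrier G \<Longrightarrow> \<phi> (x \<otimes>\<^bsub>G\<^esub> y) \<longleftrightarrow> \<phi> x \<noteq> \<phi> y"
    and odd: "\<phi> r0" "\<phi> r1" "\<phi> r2"
    and VEF: "V * (2 * k) = N" "E * (2 * m) = N" "F * (2 * n) = N" "2 * (V + E + F) = N + 4"
  shows "has_M_sequence (G, r0, r1, r2) (0, (k, m, n), (V, E, F), N)"
proof -
  have or: "orientable (G, r0, r1, r2)"
    by (rule orientable_if_parity[OF reg hom odd])
  have fl: "flags (G, r0, r1, r2) = N"
    by (simp add: flags_def card)
  have "N > 0"
    using reg card by (metis card_gt_0_iff emptyE group.subgroup_self regular_hypermap.simps subgroup.one_closed)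
  then have pos: "k > 0" "m > 0" "n > 0"
    using VEF by (auto intro!: gr0I)
  note c = regular_hypermap_counts[OF reg type, unfolded fl]
  have cnt: "num_vertices (G, r0, r1, r2) = V" "num_edges (G, r0, r1, r2) = E" "num_faces (G, r0, r1, r2) = F"
    using c VEF pos by (metis mult_right_cancel mult_pos_pos pos2 less_not_refl)+
  have "of_nat (2 * (V + E + F)) = (of_nat (N + 4) :: rat)"
    using VEF(4) by simp
  then have "euler_characteristic (G, r0, r1, r2) = 2"
    by (simp add: euler_characteristic_def cnt fl)
  then show ?thesis
    using reg or type cnt fl by (simp add: has_M_sequence_def M_sequence_def genus_def)
qed

text \<open>Euler's formula multiplied by \<open>k * m * n\<close>, with the negative term moved to
  the other side so that no subtraction on \<open>nat\<close> occurs.\<close>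

lemma on_sphere_card:
  assumes reg: "regular_hypermap (G, r0, r1, r2)" and "on_sphere (G, r0, r1, r2)"
    and type: "hypermap_type (G, r0, r1, r2) = (k, m, n)"
  shows "card (carrier G) * (m * n + k * n + k * m) = card (carrier G) * (k * m * n) + 4 * (k * m * n)"
proof -
  define V where "V = num_vertices (G, r0, r1, r2)"
  define E where "E = num_edges (G, r0, r1, r2)"
  define F where "F = num_faces (G, r0, r1, r2)"
  define N where "N = flags (G, r0, r1, r2)"
  have "(of_nat (2 * (V + E + F)) :: rat) = of_nat (N + 4)"
    using assms(2) unfolding on_sphere_def genus_def euler_characteristic_def
    by (simp add: V_def E_def F_def N_def flags_def[symmetric] del: orientable.simps split: if_splits)
  then have VEF: "2 * (V + E + F) = N + 4"
    using of_nat_eq_iff by blast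
  have c: "V * (2 * k) = N" "E * (2 * m) = N" "F * (2 * n) = N"
    using regular_hypermap_counts[OF reg type] by (simp_all add: V_def E_def F_def N_def)
  have "N * (k * m * n) + 4 * (k * m * n) = 2 * (V + E + F) * (k * m * n)"
    unfolding VEF by (simp add: algebra_simps)
  also have "\<dots> = V * (2 * k) * (m * n) + E * (2 * m) * (k * n) + F * (2 * n) * (k * m)"
    by (simp add: algebra_simps)
  also have "\<dots> = N * (m * n + k * n + k * m)"
    unfolding c by (simp add: algebra_simps)
  finally show ?thesis
    unfolding N_def flags_def by simp
qed

section \<open>The arithmetic of spherical types\<close>

text \<open>The last argument is the number of flags. Spherical triples whose third entry is 2, such
  as (3, 3, 2) or (2, m, 2), are absent because linearity excludes them.\<close>

inductive spherical_type :: "nat \<Rightarrow> nat \<Rightarrow> nat \<Rightarrow> nat \<Rightarrow> bool" where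
  "spherical_type 2 5 3 120"
| "spherical_type 2 3 5 120"
| "spherical_type 3 2 5 120"
| "spherical_type 5 2 3 120"
| "spherical_type 2 3 3 24"
| "spherical_type 3 2 3 24"
| "spherical_type 2 4 3 48"
| "spherical_type 2 3 4 48"
| "spherical_type 3 2 4 48"
| "spherical_type 4 2 3 48"
| "n \<ge> 3 \<Longrightarrow> spherical_type 2 2 n (4 * n)"

lemma spherical_typeI:
  fixes k m n N :: nat
  assumes eq: "N * (m * n + k * n + k * m) = N * (k * m * n) + 4 * (k * m * n)"
    and ge: "k \<ge> 2" "m \<ge> 2" "n \<ge> 3"
  shows "spherical_type k m n N"
proof -
  have "k * m * n > 0" using ge by simp
  then have "N * (k * m * n) < N * (m * n + k * n + k * m)"
    using eq by linarith
  then have less: "k * m * n < m * n + k * n + k * m"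
    by simp
  \<comment> \<open>Once one of \<open>k\<close>, \<open>m\<close> is 2 and the other is
    \<open>p\<close>, the condition reads (p - 2)(n - 2) < 4. Writing p = q + 2 and n = l + 3 turns
    it into \<open>q * l + q < 4\<close>.\<close>
  have small: "p = 2 \<and> n > 0 \<or> p = 3 \<and> n \<le> 5 \<or> p = 4 \<and> n = 3 \<or> p = 5 \<and> n = 3"
    if less: "2 * p * n < p * n + 2 * n + 2 * p" and p: "p \<ge> 2" for p
  proof -
    obtain q where q: "p = q + 2"
      using p by (metis add.commute le_Suc_ex)
    obtain l where l: "n = l + 3"
      using ge(3) by (metis add.commute le_Suc_ex)
    have ql: "q * l + q < 4"
      using less unfolding q l by (simp add: algebra_simps)
    then have "q < 4" by (meson le_add2 le_less_trans)
    then have "q = 0 \<or> q = 1 \<or> q = 2 \<or> q = 3" by auto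
    then show ?thesis
      using ql unfolding q l by auto
  qed
  \<comment> \<open>Otherwise \<open>k\<close>, \<open>m\<close>, \<open>n\<close> are all at least
    3, and each of the three summands in \<open>less\<close> is at most a third of
    \<open>k * m * n\<close>.\<close>
  have "k = 2 \<or> m = 2"
  proof (rule ccontr)
    assume "\<not> (k = 2 \<or> m = 2)"
    with ge have "k \<ge> 3" "m \<ge> 3" by auto
    have "3 * (m * n) \<le> k * (m * n)" "3 * (k * n) \<le> m * (k * n)" "3 * (k * m) \<le> n * (k * m)"
      using \<open>k \<ge> 3\<close> \<open>m \<ge> 3\<close> ge(3) by (intro mult_right_mono; simp)+
    then have "3 * (m * n) \<le> k * m * n" "3 * (k * n) \<le> k * m * n" "3 * (k * m) \<le> k * m * n"
      by (simp_all only: ac_simps)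
    then show False using less by linarith
  qed
  have n345: "n = 3 \<or> n = 4 \<or> n = 5" if "n \<le> 5"
    using that ge(3) by auto
  consider "k = 2" "m = 2" | "k = 2" "m = 3" "n = 3 \<or> n = 4 \<or> n = 5" | "k = 2" "m = 4 \<or> m = 5" "n = 3"
    | "m = 2" "k = 3" "n = 3 \<or> n = 4 \<or> n = 5" | "m = 2" "k = 4 \<or> k = 5" "n = 3"
    using \<open>k = 2 \<or> m = 2\<close>
  proof (elim disjE)
    assume "k = 2"
    with small[of m] less ge(2) n345 that show thesis by auto
  next
    assume "m = 2"
    with small[of k] less ge(1) n345 that show thesis by auto
  qed
  then show ?thesis
  proof cases
    case 1
    then have "N = 4 * n"
      using eq by (simp add: algebra_simps)
    then show ?thesis
      using 1 ge(3) by (simp add: spherical_type.intros)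
  qed (use eq in \<open>elim disjE; simp add: spherical_type.intros\<close>)+
qed

section \<open>Lower bounds on the orders\<close>

lemma linear_hypermap_face_order:
  assumes "regular_linear_hypermap (G, r0, r1, r2)"
  shows "group.ord G (r0 \<otimes>\<^bsub>G\<^esub> r1) \<ge> 3"
proof -
  have reg: "regular_hypermap (G, r0, r1, r2)" using assms by simp
  interpret group G using reg by simp
  have fin: "finite (carrier G)" and inv: "involution G r0" "involution G r1" "involution G r2"
    and ne: "r0 \<noteq> r1" "r0 \<noteq> r2" "r1 \<noteq> r2" using reg by auto
  have C: "r0 \<in> carrier G" "r1 \<in> carrier G" "r2 \<in> carrier G"
    and sq: "r0 \<otimes>\<^bsub>G\<^esub> r0 = \<one>\<^bsub>G\<^esub>" "r1 \<otimes>\<^bsub>G\<^esub> r1 = \<one>\<^bsub>G\<^esub>" "r2 \<otimes>\<^bsub>G\<^esub> r2 = \<one>\<^bsub>G\<^esub>" and n1: "r0 \<noteq> \<one>\<^bsub>G\<^esub>" "r1 \<noteq> \<one>\<^bsub>G\<^esub>"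
    using inv by (auto simp: involution_def)
  let ?H = "generate G {r1, r2}" and ?K = "generate G {r0, r2}"
  have HK: "?H \<inter> ?K = generate G {r2}" "(?H <#>\<^bsub>G\<^esub> ?K) \<inter> (?K <#>\<^bsub>G\<^esub> ?H) = ?H \<union> ?K"
    using assms by auto
  have sub: "subgroup ?H G" "subgroup ?K G"
    using C by (auto intro!: generate_is_subgroup)
  have r2: "generate G {r2} \<subseteq> {\<one>\<^bsub>G\<^esub>, r2}"
    by (rule generate_involutions_subset) (use inv C sq in auto)
  have mem: "r1 \<in> ?H" "r0 \<in> ?K"
    by (auto intro: generate.incl)
  \<comment> \<open>Membership would put \<open>r0\<close> or \<open>r1\<close> into the
    intersection, which is contained in the set of \<open>r2\<close> and the identity.\<close>
  have "r0 \<notin> ?H" "r1 \<notin> ?K"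
    using HK(1) r2 mem n1 ne by auto
  have notcomm: "r1 \<otimes>\<^bsub>G\<^esub> r0 \<noteq> r0 \<otimes>\<^bsub>G\<^esub> r1"
  proof
    assume comm: "r1 \<otimes>\<^bsub>G\<^esub> r0 = r0 \<otimes>\<^bsub>G\<^esub> r1"
    have "r1 \<otimes>\<^bsub>G\<^esub> r0 \<in> ?H <#>\<^bsub>G\<^esub> ?K" "r0 \<otimes>\<^bsub>G\<^esub> r1 \<in> ?K <#>\<^bsub>G\<^esub> ?H"
      using mem unfolding set_mult_def by auto
    then have "r0 \<otimes>\<^bsub>G\<^esub> r1 \<in> ?H \<union> ?K"
      using comm HK(2) by auto
    then show False
    proof
      assume "r0 \<otimes>\<^bsub>G\<^esub> r1 \<in> ?H"
      then have "(r0 \<otimes>\<^bsub>G\<^esub> r1) \<otimes>\<^bsub>G\<^esub> r1 \<in> ?H"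
        using mem by (blast intro: generate.eng)
      then show False
        using \<open>r0 \<notin> ?H\<close> C sq by (simp add: m_assoc)
    next
      assume "r0 \<otimes>\<^bsub>G\<^esub> r1 \<in> ?K"
      then have "r0 \<otimes>\<^bsub>G\<^esub> (r0 \<otimes>\<^bsub>G\<^esub> r1) \<in> ?K"
        using mem by (blast intro: generate.eng)
      then show False
        using \<open>r1 \<notin> ?K\<close> C sq by (simp flip: m_assoc)
    qed
  qed
  let ?n = "ord (r0 \<otimes>\<^bsub>G\<^esub> r1)"
  \<comment> \<open>An element whose order divides 2 is its own inverse, and the inverse of
    \<open>r0 r1\<close> is \<open>r1 r0\<close>.\<close>
  have "\<not> ?n dvd 2"
  proof
    assume "?n dvd 2"
    then have "(r0 \<otimes>\<^bsub>G\<^esub> r1) [^]\<^bsub>G\<^esub> (2::nat) = \<one>\<^bsub>G\<^esub>"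
      using C by (simp add: pow_eq_id)
    then have "(r0 \<otimes>\<^bsub>G\<^esub> r1) \<otimes>\<^bsub>G\<^esub> (r0 \<otimes>\<^bsub>G\<^esub> r1) = \<one>\<^bsub>G\<^esub>"
      using C by (simp add: numeral_2_eq_2)
    then have "r0 \<otimes>\<^bsub>G\<^esub> r1 = inv\<^bsub>G\<^esub> (r0 \<otimes>\<^bsub>G\<^esub> r1)"
      using C by (metis inv_equality m_closed)
    also have "\<dots> = r1 \<otimes>\<^bsub>G\<^esub> r0"
      using C sq inv_equality by (simp add: inv_mult_group)
    finally show False using notcomm by simp
  qed
  then have "?n \<noteq> 0 \<longrightarrow> ?n \<ge> 3"
    by (metis One_nat_def Suc_1 dvd_refl eval_nat_numeral(3) less_antisym less_one not_le one_dvd)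
  \<comment> \<open>\<open>ord\<close> is 0 for elements of infinite order, and 0 does not divide 2,
    so this value has to be excluded by finiteness.\<close>
  moreover have "?n \<noteq> 0"
    using ord_ge_1[OF fin] C by (metis m_closed not_one_le_zero)
  ultimately show ?thesis by simp
qed

lemma involution_product_order_ge_2:
  assumes "group G" "finite (carrier G)" "involution G a" "involution G b" "a \<noteq> b"
  shows "group.ord G (a \<otimes>\<^bsub>G\<^esub> b) \<ge> 2"
proof -
  interpret group G by fact
  have C: "a \<in> carrier G" "b \<in> carrier G" "b \<otimes>\<^bsub>G\<^esub> b = \<one>\<^bsub>G\<^esub>"
    using assms by (auto simp: involution_def)
  have "a \<otimes>\<^bsub>G\<^esub> b \<noteq> \<one>\<^bsub>G\<^esub>"
    using C assms(5) by (metis inv_equality)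
  then have "ord (a \<otimes>\<^bsub>G\<^esub> b) \<noteq> 1"
    using ord_eq_1 C by auto
  moreover have "ord (a \<otimes>\<^bsub>G\<^esub> b) \<ge> 1"
    using ord_ge_1[OF assms(2)] C by auto
  ultimately show ?thesis by simp
qed

section \<open>Isomorphism of hypermaps of equal spherical type\<close>

lemma hypermap_isoI:
  fixes G :: "'a monoid" and G' :: "'b monoid"
  assumes reg: "regular_hypermap (G, r0, r1, r2)" and reg': "regular_hypermap (G', s0, s1, s2)"
    and type: "hypermap_type (G, r0, r1, r2) = (k, m, n)" and type': "hypermap_type (G', s0, s1, s2) = (k, m, n)"
    and card: "card (carrier G) = N" "card (carrier G') = N"
    and bound: "\<And>R0 R1 R2 (x :: 'a \<times> 'b).
      R0 \<circ> R0 = id \<Longrightarrow> R1 \<circ> R1 = id \<Longrightarrow> R2 \<circ> R2 = id \<Longrightarrow>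
      (R1 \<circ> R2) ^^ k = id \<Longrightarrow> (R0 \<circ> R2) ^^ m = id \<Longrightarrow> (R0 \<circ> R1) ^^ n = id \<Longrightarrow>
      finite (flag_orbit {R0, R1, R2} x) \<and> card (flag_orbit {R0, R1, R2} x) \<le> N"
  shows "hypermap_iso (G, r0, r1, r2) (G', s0, s1, s2)"
proof -
  interpret G: group G using reg by simp
  interpret G': group G' using reg' by simp
  have r: "r0 \<in> carrier G" "r1 \<in> carrier G" "r2 \<in> carrier G"
      "r0 \<otimes>\<^bsub>G\<^esub> r0 = \<one>\<^bsub>G\<^esub>" "r1 \<otimes>\<^bsub>G\<^esub> r1 = \<one>\<^bsub>G\<^esub>" "r2 \<otimes>\<^bsub>G\<^esub> r2 = \<one>\<^bsub>G\<^esub>"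
    and gen: "generate G {r0, r1, r2} = carrier G" and fin: "finite (carrier G)"
    using reg by (auto simp: involution_def)
  have s: "s0 \<in> carrier G'" "s1 \<in> carrier G'" "s2 \<in> carrier G'"
      "s0 \<otimes>\<^bsub>G'\<^esub> s0 = \<one>\<^bsub>G'\<^esub>" "s1 \<otimes>\<^bsub>G'\<^esub> s1 = \<one>\<^bsub>G'\<^esub>" "s2 \<otimes>\<^bsub>G'\<^esub> s2 = \<one>\<^bsub>G'\<^esub>"
    and gen': "generate G' {s0, s1, s2} = carrier G'" and fin': "finite (carrier G')"
    using reg' by (auto simp: involution_def)
  \<comment> \<open>The action is extended by the identity outside the two carriers, so that the
    triangle relations hold as equations between total functions, as \<open>bound\<close>
    requires.\<close>
  define act where "act u v = (\<lambda>(x, y). if x \<in> carrier G \<and> y \<in> carrier G' then (x \<otimes>\<^bsub>G\<^esub> u, y \<otimes>\<^bsub>G'\<^esub> v) else (x, y))" for u v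
  have act_inv: "act u v \<circ> act u v = id"
    if "u \<in> carrier G" "v \<in> carrier G'" "u \<otimes>\<^bsub>G\<^esub> u = \<one>\<^bsub>G\<^esub>" "v \<otimes>\<^bsub>G'\<^esub> v = \<one>\<^bsub>G'\<^esub>" for u v
    using that by (auto simp: act_def fun_eq_iff G.m_assoc G'.m_assoc)
  \<comment> \<open>Right multiplications compose in reverse order; this is why \<open>rel\<close>
    passes to the swapped product, which has the same order because it is the inverse.\<close>
  have act_comp: "act u v \<circ> act u' v' = act (u' \<otimes>\<^bsub>G\<^esub> u) (v' \<otimes>\<^bsub>G'\<^esub> v)"
    if "u \<in> carrier G" "v \<in> carrier G'" "u' \<in> carrier G" "v' \<in> carrier G'" for u v u' v'
    using that by (auto simp: act_def fun_eq_iff G.m_assoc G'.m_assoc)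
  have act_one: "act \<one>\<^bsub>G\<^esub> \<one>\<^bsub>G'\<^esub> = id"
    by (auto simp: act_def fun_eq_iff)
  have act_pow: "act u v ^^ j = act (u [^]\<^bsub>G\<^esub> j) (v [^]\<^bsub>G'\<^esub> j)"
    if "u \<in> carrier G" "v \<in> carrier G'" for u v and j :: nat
    using that by (induction j) (simp_all add: act_one act_comp)
  have rel: "(act u v \<circ> act u' v') ^^ p = id"
    if "u \<in> carrier G" "v \<in> carrier G'" "u' \<in> carrier G" "v' \<in> carrier G'"
      "u \<otimes>\<^bsub>G\<^esub> u = \<one>\<^bsub>G\<^esub>" "v \<otimes>\<^bsub>G'\<^esub> v = \<one>\<^bsub>G'\<^esub>" "u' \<otimes>\<^bsub>G\<^esub> u' = \<one>\<^bsub>G\<^esub>" "v' \<otimes>\<^bsub>G'\<^esub> v' = \<one>\<^bsub>G'\<^esub>"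
      "G.ord (u \<otimes>\<^bsub>G\<^esub> u') = p" "G'.ord (v \<otimes>\<^bsub>G'\<^esub> v') = p" for u v u' v' p
  proof -
    have "inv\<^bsub>G\<^esub> (u \<otimes>\<^bsub>G\<^esub> u') = u' \<otimes>\<^bsub>G\<^esub> u" "inv\<^bsub>G'\<^esub> (v \<otimes>\<^bsub>G'\<^esub> v') = v' \<otimes>\<^bsub>G'\<^esub> v"
      using that by (simp_all add: G.inv_mult_group G'.inv_mult_group G.inv_equality G'.inv_equality)
    then have "G.ord (u' \<otimes>\<^bsub>G\<^esub> u) = p" "G'.ord (v' \<otimes>\<^bsub>G'\<^esub> v) = p"
      using that G.ord_inv[of "u \<otimes>\<^bsub>G\<^esub> u'"] G'.ord_inv[of "v \<otimes>\<^bsub>G'\<^esub> v'"] by simp_all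
    then have "(u' \<otimes>\<^bsub>G\<^esub> u) [^]\<^bsub>G\<^esub> p = \<one>\<^bsub>G\<^esub>" "(v' \<otimes>\<^bsub>G'\<^esub> v) [^]\<^bsub>G'\<^esub> p = \<one>\<^bsub>G'\<^esub>"
      using that by (auto simp: G.pow_eq_id G'.pow_eq_id)
    then show ?thesis
      using that by (simp add: act_comp act_pow act_one)
  qed
  define F where "F = {act r0 s0, act r1 s1, act r2 s2}"
  define Q where "Q = flag_orbit F (\<one>\<^bsub>G\<^esub>, \<one>\<^bsub>G'\<^esub>)"
  have "finite Q \<and> card Q \<le> N"
    unfolding Q_def F_def using type type' r s by (intro bound act_inv rel) auto
  then have Q: "finite Q" "card Q \<le> N" by auto
  have Q_carrier: "Q \<subseteq> carrier G \<times> carrier G'"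
  proof
    fix z assume "z \<in> Q"
    then show "z \<in> carrier G \<times> carrier G'"
      unfolding Q_def
      by induction (use r s in \<open>auto simp: F_def act_def split: if_splits\<close>)
  qed
  have base: "(\<one>\<^bsub>G\<^esub>, \<one>\<^bsub>G'\<^esub>) \<in> Q"
    by (simp add: Q_def flag_orbit.base)
  have step: "(x \<otimes>\<^bsub>G\<^esub> u, y \<otimes>\<^bsub>G'\<^esub> v) \<in> Q" if "(x, y) \<in> Q" "(u, v) \<in> {(r0, s0), (r1, s1), (r2, s2)}" for x y u v
  proof -
    have "act u v (x, y) \<in> Q"
      using that unfolding Q_def F_def by (auto intro: flag_orbit.step)
    then show ?thesis
      using that Q_carrier by (auto simp: act_def)
  qed
  have "carrier G \<subseteq> fst ` Q"
    unfolding gen[symmetric]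
  proof (rule G.generate_involutions_subset)
    show "fst ` Q \<subseteq> carrier G" using Q_carrier by auto
    show "\<one>\<^bsub>G\<^esub> \<in> fst ` Q" using base by force
    fix x u assume "x \<in> fst ` Q" "u \<in> {r0, r1, r2}"
    moreover from this obtain y where "(x, y) \<in> Q"
      by auto
    moreover from calculation obtain v where "(u, v) \<in> {(r0, s0), (r1, s1), (r2, s2)}"
      by blast
    ultimately have "(x \<otimes>\<^bsub>G\<^esub> u, y \<otimes>\<^bsub>G'\<^esub> v) \<in> Q"
      using step by blast
    then show "x \<otimes>\<^bsub>G\<^esub> u \<in> fst ` Q"
      by (metis fst_conv imageI)
  qed (use r in auto)
  then have fstQ: "fst ` Q = carrier G" using Q_carrier by auto
  have "carrier G' \<subseteq> snd ` Q"
    unfolding gen'[symmetric]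
  proof (rule G'.generate_involutions_subset)
    show "snd ` Q \<subseteq> carrier G'" using Q_carrier by auto
    show "\<one>\<^bsub>G'\<^esub> \<in> snd ` Q" using base by force
    fix y v assume "y \<in> snd ` Q" "v \<in> {s0, s1, s2}"
    moreover from this obtain x where "(x, y) \<in> Q"
      by auto
    moreover from calculation obtain u where "(u, v) \<in> {(r0, s0), (r1, s1), (r2, s2)}"
      by blast
    ultimately have "(x \<otimes>\<^bsub>G\<^esub> u, y \<otimes>\<^bsub>G'\<^esub> v) \<in> Q"
      using step by blast
    then show "y \<otimes>\<^bsub>G'\<^esub> v \<in> snd ` Q"
      by (metis snd_conv imageI)
  qed (use s in auto)
  then have sndQ: "snd ` Q = carrier G'" using Q_carrier by auto
  \<comment> \<open>The first projection is onto \<open>N\<close> elements and \<open>Q\<close> has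
    at most \<open>N\<close>. Equality makes both projections injective, so \<open>Q\<close> is the
    graph of a bijection.\<close>
  have "card Q = N"
    using Q card(1) fstQ card_image_le[OF Q(1), of fst] by simp
  then have inj: "inj_on fst Q" "inj_on snd Q"
    using Q(1) card fstQ sndQ by (auto intro: eq_card_imp_inj_on)
  define \<sigma> where "\<sigma> = snd \<circ> inv_into Q fst"
  have \<sigma>Q: "(x, \<sigma> x) \<in> Q" if "x \<in> carrier G" for x
  proof -
    have "x \<in> fst ` Q" using that fstQ by simp
    then have "inv_into Q fst x \<in> Q" "fst (inv_into Q fst x) = x"
      by (auto intro: inv_into_into f_inv_into_f)
    then show ?thesis
      by (metis \<sigma>_def comp_apply prod.collapse)
  qed
  have \<sigma>_eq: "\<sigma> x = y" if "(x, y) \<in> Q" for x y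
  proof -
    have "x \<in> carrier G" using that Q_carrier by auto
    from inj_onD[OF inj(1) _ \<sigma>Q[OF this] that] show ?thesis by simp
  qed
  have "bij_betw (inv_into Q fst) (carrier G) Q"
    by (rule bij_betw_inv_into) (simp add: bij_betw_def inj(1) fstQ)
  moreover have "bij_betw snd Q (carrier G')"
    by (simp add: bij_betw_def inj(2) sndQ)
  ultimately have "bij_betw \<sigma> (carrier G) (carrier G')"
    unfolding \<sigma>_def by (rule bij_betw_trans)
  moreover have "\<sigma> (x \<otimes>\<^bsub>G\<^esub> u) = \<sigma> x \<otimes>\<^bsub>G'\<^esub> v"
    if "x \<in> carrier G" "(u, v) \<in> {(r0, s0), (r1, s1), (r2, s2)}" for x u v
    using \<sigma>_eq[OF step[OF \<sigma>Q[OF that(1)] that(2)]] .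
  ultimately show ?thesis
    by auto
qed

text \<open>The enumerations expect the products A B, B C, A C to have exponents p, 3, 2, or n, 2, 2
  in the infinite family. Each type is brought into this shape by renaming the generators, with
  \<open>rel'\<close> covering the reversed products.\<close>

lemma card_orbit_spherical:
  fixes R0 R1 R2 :: "'x \<Rightarrow> 'x"
  assumes inv: "R0 \<circ> R0 = id" "R1 \<circ> R1 = id" "R2 \<circ> R2 = id"
    and rel: "(R1 \<circ> R2) ^^ k = id" "(R0 \<circ> R2) ^^ m = id" "(R0 \<circ> R1) ^^ n = id"
    and type: "spherical_type k m n N"
  shows "finite (flag_orbit {R0, R1, R2} x) \<and> card (flag_orbit {R0, R1, R2} x) \<le> N"
proof -
  have rel': "(R2 \<circ> R1) ^^ k = id" "(R2 \<circ> R0) ^^ m = id" "(R1 \<circ> R0) ^^ n = id"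
    using funpow_comp_swap_eq_id[OF inv(2) rel(1)] funpow_comp_swap_eq_id[OF inv(1) rel(2)]
      funpow_comp_swap_eq_id[OF inv(1) rel(3)] by simp_all
  have perm: "{R0, R2, R1} = {R0, R1, R2}" "{R1, R0, R2} = {R0, R1, R2}" "{R1, R2, R0} = {R0, R1, R2}"
    "{R2, R0, R1} = {R0, R1, R2}" "{R2, R1, R0} = {R0, R1, R2}"
    by auto
  from type show ?thesis
  proof cases
    case 1
    then show ?thesis using card_orbit_235[of R2 R0 R1 x] inv rel rel' by (simp add: perm)
  next
    case 2
    then show ?thesis using card_orbit_235[of R1 R0 R2 x] inv rel rel' by (simp add: perm)
  next
    case 3
    then show ?thesis using card_orbit_235[of R0 R1 R2 x] inv rel rel' by (simp add: perm)
  next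
    case 4
    then show ?thesis using card_orbit_235[of R2 R1 R0 x] inv rel rel' by (simp add: perm)
  next
    case 5
    then show ?thesis using card_orbit_233[of R1 R0 R2 x] inv rel rel' by (simp add: perm)
  next
    case 6
    then show ?thesis using card_orbit_233[of R0 R1 R2 x] inv rel rel' by (simp add: perm)
  next
    case 7
    then show ?thesis using card_orbit_234[of R2 R0 R1 x] inv rel rel' by (simp add: perm)
  next
    case 8
    then show ?thesis using card_orbit_234[of R1 R0 R2 x] inv rel rel' by (simp add: perm)
  next
    case 9
    then show ?thesis using card_orbit_234[of R0 R1 R2 x] inv rel rel' by (simp add: perm)
  next
    case 10
    then show ?thesis using card_orbit_234[of R2 R1 R0 x] inv rel rel' by (simp add: perm)
  next
    case 11
    then show ?thesis using card_orbit_22n[of R0 R1 R2 n x] inv rel rel' by (simp add: perm)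
  qed
qed

lemma spherical_hypermap_iso:
  assumes "regular_hypermap (G, r0, r1, r2)" "hypermap_type (G, r0, r1, r2) = (k, m, n)" "card (carrier G) = N"
    and "has_M_sequence (G', s0, s1, s2) (0, (k, m, n), VEF, N)"
    and "spherical_type k m n N"
  shows "hypermap_iso (G, r0, r1, r2) (G', s0, s1, s2)"
proof (rule hypermap_isoI[OF assms(1) _ assms(2) _ assms(3)])
  show "regular_hypermap (G', s0, s1, s2)" "hypermap_type (G', s0, s1, s2) = (k, m, n)" "card (carrier G') = N"
    using assms(4) by (auto simp: has_M_sequence_def M_sequence_def flags_def)
qed (rule card_orbit_spherical[OF _ _ _ _ _ _ assms(5)])

section \<open>The hypermaps on \<open>A\<^sub>5 \<times> Z\<^sub>2\<close>, \<open>S\<^sub>4\<close> and \<open>S\<^sub>4 \<times> Z\<^sub>2\<close>\<close>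

lemma (in group) subgroup_eq_carrier_if_dvd:
  assumes "finite (carrier G)" "subgroup H G" "card (carrier G) dvd card H"
  shows "H = carrier G"
proof (rule card_seteq)
  show "finite (carrier G)" "H \<subseteq> carrier G"
    using assms subgroup.subset by auto
  then have "card H > 0"
    using subgroup.one_closed[OF assms(2)] by (metis card_gt_0_iff empty_iff finite_subset)
  then show "card (carrier G) \<le> card H"
    using assms(3) by (rule dvd_imp_le[rotated])
qed

text \<open>Three dihedral subgroups bound the order of \<open>H\<close> from below by divisibility.
  For the generators of A_5 used here their orders are 4, 6, 10 with lcm 60; for S_4, orders 4, 6, 8
  have lcm 24.\<close>

lemma (in group) subgroup_eq_carrier_if_dihedral:
  assumes fin: "finite (carrier G)" and H: "subgroup H G" "a \<in> H" "b \<in> H" "c \<in> H"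
    and sq: "a \<otimes> a = \<one>" "b \<otimes> b = \<one>" "c \<otimes> c = \<one>"
    and ne: "a \<noteq> \<one>" "b \<noteq> \<one>" "c \<noteq> \<one>" "a \<noteq> b" "a \<noteq> c" "b \<noteq> c"
    and dvd: "card (carrier G) dvd lcm (2 * ord (b \<otimes> c)) (lcm (2 * ord (a \<otimes> c)) (2 * ord (a \<otimes> b)))"
  shows "H = carrier G"
proof (rule subgroup_eq_carrier_if_dvd[OF fin H(1)])
  have C: "a \<in> carrier G" "b \<in> carrier G" "c \<in> carrier G"
    using H(2-4) by (auto intro: subgroup.mem_carrier[OF H(1)])
  have "2 * ord (b \<otimes> c) dvd card H" "2 * ord (a \<otimes> c) dvd card H" "2 * ord (a \<otimes> b) dvd card H"
    using card_generate_dvd[OF H(1), of "{b, c}"] card_generate_dvd[OF H(1), of "{a, c}"]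
      card_generate_dvd[OF H(1), of "{a, b}"] card_generate_two_involutions[OF fin] C H sq ne
    by simp_all
  then show "card (carrier G) dvd card H"
    using dvd by (meson dvd_trans lcm_least)
qed

lemma (in group) ord_eq_primeI:
  assumes "x \<in> carrier G" "x \<noteq> \<one>" "x [^] p = \<one>" "Factorial_Ring.prime p"
  shows "ord x = p"
  using assms by (metis ord_eq_1 pow_eq_id prime_nat_iff)

lemma (in group) ord_eq_4I:
  assumes "x \<in> carrier G" "x [^] (2::nat) \<noteq> \<one>" "x [^] (4::nat) = \<one>"
  shows "ord x = 4"
proof -
  have d: "ord x dvd 4" "\<not> ord x dvd 2"
    using assms by (simp_all add: pow_eq_id)
  then have "ord x \<le> 4" "ord x \<noteq> 0"
    by (auto dest: dvd_imp_le intro!: gr0I)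
  then have "ord x = 1 \<or> ord x = 2 \<or> ord x = 3 \<or> ord x = 4"
    by auto
  then show ?thesis using d by auto
qed

lemma pow_DirProd_Z2:
  fixes j :: nat
  shows "(p, i) [^]\<^bsub>A \<times>\<times> integer_mod_group 2\<^esub> j = (p [^]\<^bsub>A\<^esub> j, int j * i mod 2)"
proof (induction j)
  case 0
  then show ?case by (simp add: nat_pow_def one_DirProd)
next
  case (Suc j)
  have "(int j * i mod 2 + i) mod 2 = int (Suc j) * i mod 2"
    by (simp add: mod_simps algebra_simps)
  then show ?case
    using Suc by (simp add: nat_pow_def mult_DirProd')
qed

text \<open>The parity condition makes the second component vanish whenever the power of
  \<open>p\<close> is trivial, so the order does not double.\<close>

lemma ord_DirProd_Z2:
  assumes "group A" "p \<in> carrier A" "i \<in> {0, 1}" "even (int (group.ord A p) * i)"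
  shows "group.ord (A \<times>\<times> integer_mod_group 2) (p, i) = group.ord A p"
proof -
  interpret A: group A by fact
  interpret P: group "A \<times>\<times> integer_mod_group 2"
    using assms(1) by (intro DirProd_group) simp_all
  have C: "(p, i) \<in> carrier (A \<times>\<times> integer_mod_group 2)"
    using assms by (auto simp: carrier_integer_mod_group)
  have "(p, i) [^]\<^bsub>A \<times>\<times> integer_mod_group 2\<^esub> j = \<one>\<^bsub>A \<times>\<times> integer_mod_group 2\<^esub> \<longleftrightarrow> A.ord p dvd j" for j :: nat
  proof -
    have "even (int j * i)" if "A.ord p dvd j"
      using that assms(4) by (auto elim!: dvdE)
    then show ?thesis
      using A.pow_eq_id[OF assms(2), of j] by (auto simp: pow_DirProd_Z2 even_iff_mod_2_eq_zero)
  qed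
  then show ?thesis
    using P.ord_unique[OF C] by blast
qed

text \<open>Over each element of \<open>A\<close> the subgroup has at least one point, and
  multiplying by the central element gives the other.\<close>

lemma subgroup_DirProd_Z2_eq_carrier:
  assumes A: "group A" and H: "subgroup H (A \<times>\<times> integer_mod_group 2)"
    and z: "(\<one>\<^bsub>A\<^esub>, 1) \<in> H" and fst: "fst ` H = carrier A"
  shows "H = carrier (A \<times>\<times> integer_mod_group 2)"
proof
  interpret A: group A by fact
  show "H \<subseteq> carrier (A \<times>\<times> integer_mod_group 2)"
    using H by (rule subgroup.subset)
  show "carrier (A \<times>\<times> integer_mod_group 2) \<subseteq> H"
  proof clarify
    fix p and i :: int
    assume pi: "(p, i) \<in> carrier (A \<times>\<times> integer_mod_group 2)"
    then have p: "p \<in> carrier A" and i: "i = 0 \<or> i = 1"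
      by (auto simp: carrier_integer_mod_group)
    from p fst obtain j where j: "(p, j) \<in> H"
      by (metis imageE prod.collapse)
    then have "(p, j) \<in> carrier (A \<times>\<times> integer_mod_group 2)"
      using H by (auto dest: subgroup.mem_carrier)
    then have j01: "j = 0 \<or> j = 1"
      by (auto simp: carrier_integer_mod_group)
    have "(p, j) \<otimes>\<^bsub>A \<times>\<times> integer_mod_group 2\<^esub> (\<one>\<^bsub>A\<^esub>, 1) \<in> H"
      using H j z by (rule subgroup.m_closed)
    then have "(p, (j + 1) mod 2) \<in> H"
      using p by simp
    then show "(p, i) \<in> H"
      using j i j01 by auto
  qed
qed

text \<open>In the triangle groups with central inversion, a suitable power of the Coxeter element
  \<open>r0 r1 r2\<close> is that inversion; it generates the factor of order two.\<close>

lemma has_M_sequence_DirProd_Z2: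
  fixes A :: "'a monoid" and e0 e1 e2 :: int
  assumes A: "group A" "finite (carrier A)"
    and p: "p0 \<in> carrier A" "p1 \<in> carrier A" "p2 \<in> carrier A"
      "p0 \<otimes>\<^bsub>A\<^esub> p0 = \<one>\<^bsub>A\<^esub>" "p1 \<otimes>\<^bsub>A\<^esub> p1 = \<one>\<^bsub>A\<^esub>" "p2 \<otimes>\<^bsub>A\<^esub> p2 = \<one>\<^bsub>A\<^esub>"
    and ne: "p0 \<noteq> \<one>\<^bsub>A\<^esub>" "p1 \<noteq> \<one>\<^bsub>A\<^esub>" "p2 \<noteq> \<one>\<^bsub>A\<^esub>" "p0 \<noteq> p1" "p0 \<noteq> p2" "p1 \<noteq> p2"
    and e: "e0 \<in> {0, 1}" "e1 \<in> {0, 1}" "e2 \<in> {0, 1}"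
    and ord: "group.ord A (p1 \<otimes>\<^bsub>A\<^esub> p2) = k" "group.ord A (p0 \<otimes>\<^bsub>A\<^esub> p2) = m" "group.ord A (p0 \<otimes>\<^bsub>A\<^esub> p1) = n"
    and even: "even (int k * (e1 + e2))" "even (int m * (e0 + e2))" "even (int n * (e0 + e1))"
    and N: "2 * card (carrier A) = N" "N dvd 2 * lcm (2 * k) (lcm (2 * m) (2 * n))"
    and coxeter: "(p0 \<otimes>\<^bsub>A\<^esub> p1 \<otimes>\<^bsub>A\<^esub> p2) [^]\<^bsub>A\<^esub> h = \<one>\<^bsub>A\<^esub>" "odd (int h * (e0 + e1 + e2))"
    and hom: "\<And>x y. x \<in> carrier A \<Longrightarrow> y \<in> carrier A \<Longrightarrow> \<psi> (x \<otimes>\<^bsub>A\<^esub> y) \<longleftrightarrow> \<psi> x \<noteq> \<psi> y"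
    and parity: "\<psi> p0 \<noteq> (e0 = 1)" "\<psi> p1 \<noteq> (e1 = 1)" "\<psi> p2 \<noteq> (e2 = 1)"
    and VEF: "V * (2 * k) = N" "E * (2 * m) = N" "F * (2 * n) = N" "2 * (V + E + F) = N + 4"
  shows "has_M_sequence (A \<times>\<times> integer_mod_group 2, (p0, e0), (p1, e1), (p2, e2)) (0, (k, m, n), (V, E, F), N)"
proof -
  let ?P = "A \<times>\<times> integer_mod_group 2"
  interpret A: group A by fact
  interpret P: group ?P
    using A(1) by (intro DirProd_group) simp_all
  have cZ: "carrier (integer_mod_group 2) = {0, 1}"
    by (auto simp: carrier_integer_mod_group)
  have C: "(p0, e0) \<in> carrier ?P" "(p1, e1) \<in> carrier ?P" "(p2, e2) \<in> carrier ?P"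
    using p e by (auto simp: cZ)
  let ?H = "generate ?P {(p0, e0), (p1, e1), (p2, e2)}"
  have H: "subgroup ?H ?P"
    using C by (intro P.generate_is_subgroup) auto
  have rH: "(p0, e0) \<in> ?H" "(p1, e1) \<in> ?H" "(p2, e2) \<in> ?H"
    by (auto intro: generate.incl)
  have "group_hom ?P A fst"
    by unfold_locales (auto simp: hom_def)
  then have fstH: "subgroup (fst ` ?H) A"
    using H by (rule group_hom.subgroup_img_is_subgroup)
  have "fst ` ?H = carrier A"
  proof (rule A.subgroup_eq_carrier_if_dihedral[OF A(2) fstH _ _ _ p(4-6) ne])
    show "p0 \<in> fst ` ?H" "p1 \<in> fst ` ?H" "p2 \<in> fst ` ?H"
      using rH by force+
    show "card (carrier A) dvd lcm (2 * A.ord (p1 \<otimes>\<^bsub>A\<^esub> p2)) (lcm (2 * A.ord (p0 \<otimes>\<^bsub>A\<^esub> p2)) (2 * A.ord (p0 \<otimes>\<^bsub>A\<^esub> p1)))"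
      using N by (auto simp: ord)
  qed
  moreover have "(\<one>\<^bsub>A\<^esub>, 1) \<in> ?H"
  proof -
    let ?w = "(p0, e0) \<otimes>\<^bsub>?P\<^esub> (p1, e1) \<otimes>\<^bsub>?P\<^esub> (p2, e2)"
    have "?w \<in> ?H"
      using rH by (blast intro: generate.eng)
    then have "?w [^]\<^bsub>?P\<^esub> int h \<in> ?H"
      using H by (rule P.subgroup_int_pow_closed[rotated])
    moreover have "?w [^]\<^bsub>?P\<^esub> h = (\<one>\<^bsub>A\<^esub>, int h * (e0 + e1 + e2) mod 2)"
      using coxeter(1) by (simp add: pow_DirProd_Z2 mod_simps)
    moreover have "int h * (e0 + e1 + e2) mod 2 = 1"
      using coxeter(2) by (simp only: odd_iff_mod_2_eq_one)
    ultimately show ?thesis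
      by (simp only: int_pow_int)
  qed
  ultimately have gen: "?H = carrier ?P"
    by (intro subgroup_DirProd_Z2_eq_carrier A(1) H)
  have sq: "(e0 + e0) mod 2 = 0" "(e1 + e1) mod 2 = 0" "(e2 + e2) mod 2 = 0"
    using e by auto
  have reg: "regular_hypermap (?P, (p0, e0), (p1, e1), (p2, e2))"
    using A(2) C gen ne p sq P.group_axioms by (simp add: involution_def cZ one_DirProd)
  have "P.ord ((q, i) \<otimes>\<^bsub>?P\<^esub> (q', j)) = A.ord (q \<otimes>\<^bsub>A\<^esub> q')"
    if "q \<in> carrier A" "q' \<in> carrier A" "even (int (A.ord (q \<otimes>\<^bsub>A\<^esub> q')) * (i + j))" for q q' i j
  proof -
    have "(i + j) mod 2 \<in> {0, 1}"
      by auto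
    moreover have "even (int (A.ord (q \<otimes>\<^bsub>A\<^esub> q')) * ((i + j) mod 2))"
      using that(3) by (simp only: even_mult_iff even_mod_2_iff)
    ultimately show ?thesis
      using ord_DirProd_Z2[OF A(1), of "q \<otimes>\<^bsub>A\<^esub> q'"] that(1,2) by simp
  qed
  then have type: "hypermap_type (?P, (p0, e0), (p1, e1), (p2, e2)) = (k, m, n)"
    using p even by (simp add: ord)
  show ?thesis
  proof (rule has_M_sequence_sphereI[OF reg type])
    show "card (carrier ?P) = N"
      using N(1) by (simp add: cZ card_cartesian_product)
    \<comment> \<open>The product of two characters of order at most 2: one on \<open>A\<close> and
      the second coordinate.\<close>
    let ?\<phi> = "\<lambda>(p, i). \<psi> p \<noteq> (i = (1 :: int))"
    show "?\<phi> (x \<otimes>\<^bsub>?P\<^esub> y) \<longleftrightarrow> ?\<phi> x \<noteq> ?\<phi> y" if "x \<in> carrier ?P" "y \<in> carrier ?P" for x y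
      using that hom by (auto simp: cZ)
    show "?\<phi> (p0, e0)" "?\<phi> (p1, e1)" "?\<phi> (p2, e2)"
      using parity by auto
  qed (fact VEF)+
qed

section \<open>Computing with explicit permutations\<close>

lemma pow_sym_group: "p [^]\<^bsub>sym_group n\<^esub> (j::nat) = p ^^ j"
  by (induction j) (simp_all add: nat_pow_def sym_group_one sym_group_mult flip: funpow_swap1 funpow_Suc_right)

lemma pow_alt_group: "p [^]\<^bsub>alt_group n\<^esub> (j::nat) = p ^^ j"
  by (induction j) (simp_all add: nat_pow_def alt_group_one alt_group_mult flip: funpow_swap1 funpow_Suc_right)

text \<open>Reduces equality of concrete permutations to five evaluations, which the simplifier
  decides. It also serves for S_4, whose elements permute \<open>{1..5}\<close> as well.\<close>

lemma permutes_5_eq_iff: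
  fixes p q :: "nat \<Rightarrow> nat"
  assumes "p permutes {1..5}" "q permutes {1..5}"
  shows "p = q \<longleftrightarrow> p 1 = q 1 \<and> p 2 = q 2 \<and> p 3 = q 3 \<and> p 4 = q 4 \<and> p 5 = q 5"
proof
  assume *: "p 1 = q 1 \<and> p 2 = q 2 \<and> p 3 = q 3 \<and> p 4 = q 4 \<and> p 5 = q 5"
  show "p = q"
  proof
    fix x
    have "x \<in> {1..5::nat} \<Longrightarrow> x = 1 \<or> x = 2 \<or> x = 3 \<or> x = 4 \<or> x = 5"
      by auto
    then show "p x = q x"
      using * assms by (cases "x \<in> {1..5}") (auto simp: permutes_not_in)
  qed
qed simp

lemma finite_sym_group: "finite (carrier (sym_group n))"
  by (simp add: sym_group_def finite_permutations)

lemma finite_alt_group: "finite (carrier (alt_group n))"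
  by (rule finite_subset[OF _ finite_sym_group[of n]]) (auto simp: alt_group_carrier sym_group_carrier)

text \<open>For prime \<open>k\<close> a nontrivial element with trivial \<open>k\<close>-th power
  has order \<open>k\<close>; 4 is the only composite value and needs its square checked.\<close>

lemma ord_permutation:
  assumes "group A" "p \<in> carrier A" "\<one>\<^bsub>A\<^esub> = id" "\<And>j::nat. p [^]\<^bsub>A\<^esub> j = p ^^ j"
    and "k \<in> {2, 3, 4, 5}" "p ^^ k = id" "p \<noteq> id" "k = 4 \<longrightarrow> p ^^ 2 \<noteq> id"
  shows "group.ord A p = k"
proof (cases "k = 4")
  case True
  then show ?thesis
    using assms group.ord_eq_4I[OF assms(1,2)] by simp
next
  case False
  then have "Factorial_Ring.prime k"
    using assms(5) by auto
  then show ?thesis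
    using assms group.ord_eq_primeI[OF assms(1,2)] by simp
qed

lemma has_M_sequence_G1:
  assumes perm: "p0 permutes {1..5}" "p1 permutes {1..5}" "p2 permutes {1..5}"
      "evenperm p0" "evenperm p1" "evenperm p2"
    and sq: "p0 \<circ> p0 = id" "p1 \<circ> p1 = id" "p2 \<circ> p2 = id"
    and ne: "p0 \<noteq> id" "p1 \<noteq> id" "p2 \<noteq> id" "p0 \<noteq> p1" "p0 \<noteq> p2" "p1 \<noteq> p2"
    and pow: "(p1 \<circ> p2) ^^ k = id" "(p0 \<circ> p2) ^^ m = id" "(p0 \<circ> p1) ^^ n = id"
    and coxeter: "(p0 \<circ> p1 \<circ> p2) ^^ 5 = id"
    and type: "(k, m, n) \<in> {(2, 5, 3), (2, 3, 5), (3, 2, 5), (5, 2, 3)}"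
    and VEF: "V = 60 div k" "E = 60 div m" "F = 60 div n"
  shows "has_M_sequence (G1, (p0, 1), (p1, 1), (p2, 1)) (0, (k, m, n), (V, E, F), 120)"
  unfolding G1_def
\<comment> \<open>5 is half the Coxeter number 10 of the icosahedral group H_3. A_5 has no
  nontrivial character to the group of order 2, so the second coordinate alone is the
  parity.\<close>
proof (rule has_M_sequence_DirProd_Z2[where h = 5 and \<psi> = "\<lambda>_. False"])
  show A: "group (alt_group 5)" "finite (carrier (alt_group 5))"
    by (simp_all add: alt_group_is_group finite_alt_group)
  have ord: "group.ord (alt_group 5) (p \<otimes>\<^bsub>alt_group 5\<^esub> q) = j"
    if "p permutes {1..5}" "q permutes {1..5}" "evenperm p" "evenperm q" "p \<noteq> q" "q \<circ> q = id"
      "(p \<circ> q) ^^ j = id" "j \<in> {2, 3, 5}" for p q j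
  proof (rule ord_permutation[OF A(1)])
    show "p \<otimes>\<^bsub>alt_group 5\<^esub> q \<noteq> id"
      using that(5,6) by (metis alt_group_mult comp_assoc comp_id id_comp)
    have "permutation p" "permutation q"
      using that(1,2) by (auto simp: permutation_permutes)
    then show "p \<otimes>\<^bsub>alt_group 5\<^esub> q \<in> carrier (alt_group 5)"
      using that by (simp add: alt_group_carrier alt_group_mult permutes_compose evenperm_comp)
  qed (use that in \<open>auto simp: alt_group_one alt_group_mult pow_alt_group\<close>)
  show "group.ord (alt_group 5) (p1 \<otimes>\<^bsub>alt_group 5\<^esub> p2) = k" "group.ord (alt_group 5) (p0 \<otimes>\<^bsub>alt_group 5\<^esub> p2) = m"
    "group.ord (alt_group 5) (p0 \<otimes>\<^bsub>alt_group 5\<^esub> p1) = n"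
    using perm ne sq pow type by (intro ord; auto)+
  have "(120::nat) dvd 2 * lcm (2 * 2) (lcm (2 * 5) (2 * 3))" "(120::nat) dvd 2 * lcm (2 * 2) (lcm (2 * 3) (2 * 5))"
    "(120::nat) dvd 2 * lcm (2 * 3) (lcm (2 * 2) (2 * 5))" "(120::nat) dvd 2 * lcm (2 * 5) (lcm (2 * 2) (2 * 3))"
    by code_simp+
  then show "120 dvd 2 * lcm (2 * k) (lcm (2 * m) (2 * n))"
    using type by auto
  show "2 * card (carrier (alt_group 5)) = 120"
    using alt_group_card_carrier[of 5] by (simp add: fact_numeral)
  show "V * (2 * k) = 120" "E * (2 * m) = 120" "F * (2 * n) = 120" "2 * (V + E + F) = 120 + 4"
    using type VEF by auto
  show "p0 \<in> carrier (alt_group 5)" "p1 \<in> carrier (alt_group 5)" "p2 \<in> carrier (alt_group 5)"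
    unfolding alt_group_carrier by (intro conjI perm)+
qed (simp_all add: sq ne coxeter alt_group_carrier alt_group_mult alt_group_one pow_alt_group)

lemma even_perm_comp_iff:
  assumes "p permutes {1..n::nat}" "q permutes {1..n}"
  shows "evenperm (p \<circ> q) \<longleftrightarrow> (evenperm p \<longleftrightarrow> evenperm q)"
  using assms by (intro evenperm_comp) (auto simp: permutation_permutes)

lemma ord_sym_group_mult:
  assumes "p permutes {1..n}" "q permutes {1..n}" "p \<noteq> q" "q \<circ> q = id"
    "(p \<circ> q) ^^ j = id" "j \<in> {2, 3, 4, 5}" "j = 4 \<longrightarrow> (p \<circ> q) ^^ 2 \<noteq> id"
  shows "group.ord (sym_group n) (p \<otimes>\<^bsub>sym_group n\<^esub> q) = j"
proof (rule ord_permutation[OF sym_group_is_group])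
  show "p \<otimes>\<^bsub>sym_group n\<^esub> q \<noteq> id"
    using assms(3,4) by (metis sym_group_mult comp_assoc comp_id id_comp)
  show "p \<otimes>\<^bsub>sym_group n\<^esub> q \<in> carrier (sym_group n)"
    using assms by (simp add: sym_group_carrier sym_group_mult permutes_compose)
qed (use assms in \<open>auto simp: sym_group_one sym_group_mult pow_sym_group\<close>)

text \<open>\<open>s\<close> selects the parity homomorphism. With \<open>True\<close> the sign of
  the permutation is combined with the second coordinate; with \<open>False\<close> the second
  coordinate is used alone, as when all three generators involve the central factor.\<close>

lemma has_M_sequence_G3:
  assumes perm: "p0 permutes {1..4}" "p1 permutes {1..4}" "p2 permutes {1..4}"
    and sq: "p0 \<circ> p0 = id" "p1 \<circ> p1 = id" "p2 \<circ> p2 = id"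
    and ne: "p0 \<noteq> id" "p1 \<noteq> id" "p2 \<noteq> id" "p0 \<noteq> p1" "p0 \<noteq> p2" "p1 \<noteq> p2"
    and e: "e0 \<in> {0, 1}" "e1 \<in> {0, 1}" "e2 \<in> {0, 1}"
    and pow: "(p1 \<circ> p2) ^^ k = id" "(p0 \<circ> p2) ^^ m = id" "(p0 \<circ> p1) ^^ n = id"
      "k = 4 \<longrightarrow> (p1 \<circ> p2) ^^ 2 \<noteq> id" "m = 4 \<longrightarrow> (p0 \<circ> p2) ^^ 2 \<noteq> id" "n = 4 \<longrightarrow> (p0 \<circ> p1) ^^ 2 \<noteq> id"
    and even: "even (int k * (e1 + e2))" "even (int m * (e0 + e2))" "even (int n * (e0 + e1))"
    and coxeter: "(p0 \<circ> p1 \<circ> p2) ^^ 3 = id" "odd (e0 + e1 + e2)"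
    and parity: "(s \<and> \<not> evenperm p0) \<noteq> (e0 = 1)" "(s \<and> \<not> evenperm p1) \<noteq> (e1 = 1)" "(s \<and> \<not> evenperm p2) \<noteq> (e2 = 1)"
    and type: "(k, m, n) \<in> {(2, 4, 3), (2, 3, 4), (3, 2, 4), (4, 2, 3)}"
    and VEF: "V = 24 div k" "E = 24 div m" "F = 24 div n"
  shows "has_M_sequence (G3, (p0, e0), (p1, e1), (p2, e2)) (0, (k, m, n), (V, E, F), 48)"
  unfolding G3_def
\<comment> \<open>3 is half the Coxeter number 6 of the octahedral group B_3.\<close>
proof (rule has_M_sequence_DirProd_Z2[where h = 3 and \<psi> = "\<lambda>p. s \<and> \<not> evenperm p"])
  show "group (sym_group 4)" "finite (carrier (sym_group 4))"
    by (simp_all add: sym_group_is_group finite_sym_group)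
  show "group.ord (sym_group 4) (p1 \<otimes>\<^bsub>sym_group 4\<^esub> p2) = k" "group.ord (sym_group 4) (p0 \<otimes>\<^bsub>sym_group 4\<^esub> p2) = m"
    "group.ord (sym_group 4) (p0 \<otimes>\<^bsub>sym_group 4\<^esub> p1) = n"
    using perm ne sq pow type by (intro ord_sym_group_mult; auto)+
  have "(48::nat) dvd 2 * lcm (2 * 2) (lcm (2 * 4) (2 * 3))" "(48::nat) dvd 2 * lcm (2 * 2) (lcm (2 * 3) (2 * 4))"
    "(48::nat) dvd 2 * lcm (2 * 3) (lcm (2 * 2) (2 * 4))" "(48::nat) dvd 2 * lcm (2 * 4) (lcm (2 * 2) (2 * 3))"
    by code_simp+
  then show "48 dvd 2 * lcm (2 * k) (lcm (2 * m) (2 * n))"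
    using type by auto
  show "2 * card (carrier (sym_group 4)) = 48"
    using sym_group_card_carrier[of 4] by (simp add: fact_numeral)
  show "(s \<and> \<not> evenperm (x \<otimes>\<^bsub>sym_group 4\<^esub> y)) \<longleftrightarrow> (s \<and> \<not> evenperm x) \<noteq> (s \<and> \<not> evenperm y)"
    if "x \<in> carrier (sym_group 4)" "y \<in> carrier (sym_group 4)" for x y
    using that even_perm_comp_iff[of x 4 y] by (auto simp: sym_group_mult sym_group_carrier)
  show "odd (int 3 * (e0 + e1 + e2))"
    using coxeter(2) by simp
  show "V * (2 * k) = 48" "E * (2 * m) = 48" "F * (2 * n) = 48" "2 * (V + E + F) = 48 + 4"
    using type VEF by auto
  show "p0 \<in> carrier (sym_group 4)" "p1 \<in> carrier (sym_group 4)" "p2 \<in> carrier (sym_group 4)"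
    unfolding sym_group_carrier by (fact perm)+
qed (use e even parity in \<open>simp_all add: sq ne coxeter sym_group_carrier sym_group_mult sym_group_one pow_sym_group\<close>)

lemma funpow_numerals:
  "(f ^^ 2) x = f (f x)" "(f ^^ 3) x = f (f (f x))" "(f ^^ 4) x = f (f (f (f x)))"
  "(f ^^ 5) x = f (f (f (f (f x))))"
  by (simp_all add: eval_nat_numeral)

lemmas perm_simps = permutes_5_eq_iff permutes_compose permutes_swap_id permutes_id permutes_funpow
  evenperm_comp evenperm_swap permutation_compose permutation_swap_id funpow_numerals

lemma has_M_sequences_G1:
  "has_M_sequence (G1, (transpose 1 2 \<circ> transpose 3 5, 1), (transpose 1 2 \<circ> transpose 3 4, 1), (transpose 1 3 \<circ> transpose 2 4, 1))
    (0, (2, 5, 3), (30, 12, 20), 120)"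
  "has_M_sequence (G1, (transpose 1 2 \<circ> transpose 3 5, 1), (transpose 1 3 \<circ> transpose 2 4, 1), (transpose 1 2 \<circ> transpose 3 4, 1))
    (0, (2, 3, 5), (30, 20, 12), 120)"
  "has_M_sequence (G1, (transpose 1 4 \<circ> transpose 3 5, 1), (transpose 1 2 \<circ> transpose 4 5, 1), (transpose 1 3 \<circ> transpose 4 5, 1))
    (0, (3, 2, 5), (20, 30, 12), 120)"
  "has_M_sequence (G1, (transpose 1 4 \<circ> transpose 3 5, 1), (transpose 1 4 \<circ> transpose 2 3, 1), (transpose 1 3 \<circ> transpose 4 5, 1))
    (0, (5, 2, 3), (12, 30, 20), 120)"
proof goal_cases
  case 1
  show ?case
    by (rule has_M_sequence_G1) (simp_all add: perm_simps)
next
  case 2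
  show ?case
    by (rule has_M_sequence_G1) (simp_all add: perm_simps)
next
  case 3
  show ?case
    by (rule has_M_sequence_G1) (simp_all add: perm_simps)
next
  case 4
  show ?case
    by (rule has_M_sequence_G1) (simp_all add: perm_simps)
qed

lemma has_M_sequences_G3:
  "has_M_sequence (G3, (transpose 1 3, 0), (transpose 3 4, 0), (transpose 1 2 \<circ> transpose 3 4, 1))
    (0, (2, 4, 3), (12, 6, 8), 48)"
  "has_M_sequence (G3, (transpose 1 3, 0), (transpose 1 2 \<circ> transpose 3 4, 1), (transpose 3 4, 0))
    (0, (2, 3, 4), (12, 8, 6), 48)"
  "has_M_sequence (G3, (transpose 1 2 \<circ> transpose 3 4, 1), (transpose 1 3, 0), (transpose 1 2, 0))
    (0, (3, 2, 4), (8, 12, 6), 48)"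
proof goal_cases
  case 1
  show ?case
    by (rule has_M_sequence_G3[where s = True]) (simp_all add: perm_simps)
next
  case 2
  show ?case
    by (rule has_M_sequence_G3[where s = True]) (simp_all add: perm_simps)
next
  case 3
  show ?case
    by (rule has_M_sequence_G3[where s = True]) (simp_all add: perm_simps)
qed

lemma has_M_sequences_G3':
  "has_M_sequence (G3, (transpose 1 3, 1), (transpose 1 2, 1), (transpose 1 3 \<circ> transpose 2 4, 1))
    (0, (4, 2, 3), (6, 12, 8), 48)"
  by (rule has_M_sequence_G3[where s = False]) (simp_all add: perm_simps)

text \<open>The transpositions themselves give dihedral subgroups of orders 6, 6, 4, whose lcm 12 is
  too small. Replacing (34) by the product (12)(34), which lies in the same subgroup, gives one of
  order 8 and raises the lcm to 24.\<close>

lemma generate_sym_group_4: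
  "generate (sym_group 4) {transpose 1 3, transpose 1 2, transpose 3 4} = carrier (sym_group 4)"
    (is "?H = _")
proof -
  interpret group "sym_group 4"
    by (rule sym_group_is_group)
  let ?a = "transpose 1 3 :: nat \<Rightarrow> nat" and ?b = "transpose 1 2 \<circ> transpose 3 4 :: nat \<Rightarrow> nat"
    and ?c = "transpose 1 2 :: nat \<Rightarrow> nat"
  have H: "subgroup ?H (sym_group 4)"
    by (rule generate_is_subgroup) (auto simp: sym_group_carrier permutes_swap_id)
  have ord: "ord (?b \<otimes>\<^bsub>sym_group 4\<^esub> ?c) = 2" "ord (?a \<otimes>\<^bsub>sym_group 4\<^esub> ?c) = 3" "ord (?a \<otimes>\<^bsub>sym_group 4\<^esub> ?b) = 4"
    by (rule ord_sym_group_mult; simp add: perm_simps)+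
  show ?thesis
  proof (rule subgroup_eq_carrier_if_dihedral[of _ ?a ?b ?c])
    show "finite (carrier (sym_group 4))"
      by (rule finite_sym_group)
    show "subgroup ?H (sym_group 4)"
      by (rule H)
    show "?a \<in> ?H" "?c \<in> ?H"
      by (auto intro: generate.incl)
    have "?c \<otimes>\<^bsub>sym_group 4\<^esub> transpose 3 4 \<in> ?H"
      by (auto intro: generate.eng generate.incl)
    then show "?b \<in> ?H"
      by (simp add: sym_group_mult)
    have "(24::nat) dvd lcm (2 * 2) (lcm (2 * 3) (2 * 4))"
      by code_simp
    then show "card (carrier (sym_group 4)) dvd lcm (2 * ord (?b \<otimes>\<^bsub>sym_group 4\<^esub> ?c))
      (lcm (2 * ord (?a \<otimes>\<^bsub>sym_group 4\<^esub> ?c)) (2 * ord (?a \<otimes>\<^bsub>sym_group 4\<^esub> ?b)))"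
      unfolding ord using sym_group_card_carrier[of 4] by (simp add: fact_numeral)
  qed (simp_all add: sym_group_mult sym_group_one perm_simps)
qed

lemma has_M_sequences_G2:
  "has_M_sequence (G2, transpose 1 3, transpose 1 2, transpose 3 4) (0, (2, 3, 3), (6, 4, 4), 24)"
  "has_M_sequence (G2, transpose 3 4, transpose 1 3, transpose 1 2) (0, (3, 2, 3), (4, 6, 4), 24)"
proof -
  have card: "card (carrier G2) = 24"
    using sym_group_card_carrier[of 4] by (simp add: G2_def fact_numeral)
  have hom: "(\<not> evenperm (x \<otimes>\<^bsub>G2\<^esub> y)) \<longleftrightarrow> (\<not> evenperm x) \<noteq> (\<not> evenperm y)"
    if "x \<in> carrier G2" "y \<in> carrier G2" for x y
    using that even_perm_comp_iff[of x 4 y] by (auto simp: G2_def sym_group_mult sym_group_carrier)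
  have invol: "involution G2 (transpose 1 3)" "involution G2 (transpose 1 2)" "involution G2 (transpose 3 4)"
    by (simp_all add: involution_def G2_def sym_group_carrier sym_group_mult sym_group_one permutes_swap_id transpose_eq_id_iff)
  have distinct: "distinct [transpose 1 3, transpose 1 2, transpose 3 4 :: nat \<Rightarrow> nat]"
    "distinct [transpose 3 4, transpose 1 3, transpose 1 2 :: nat \<Rightarrow> nat]"
    by (simp_all add: perm_simps)
  have ord: "group.ord G2 (transpose 1 2 \<otimes>\<^bsub>G2\<^esub> transpose 3 4) = 2" "group.ord G2 (transpose 1 3 \<otimes>\<^bsub>G2\<^esub> transpose 3 4) = 3"
    "group.ord G2 (transpose 1 3 \<otimes>\<^bsub>G2\<^esub> transpose 1 2) = 3" "group.ord G2 (transpose 3 4 \<otimes>\<^bsub>G2\<^esub> transpose 1 2) = 2"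
    "group.ord G2 (transpose 3 4 \<otimes>\<^bsub>G2\<^esub> transpose 1 3) = 3"
    unfolding G2_def by (rule ord_sym_group_mult; simp add: perm_simps)+
  have gen: "generate G2 {transpose 1 3, transpose 1 2, transpose 3 4} = carrier G2"
    unfolding G2_def by (rule generate_sym_group_4)
  moreover have "{transpose 3 4, transpose 1 3, transpose 1 2 :: nat \<Rightarrow> nat} = {transpose 1 3, transpose 1 2, transpose 3 4}"
    by auto
  ultimately have gen': "generate G2 {transpose 3 4, transpose 1 3, transpose 1 2} = carrier G2"
    by simp
  have grp: "group G2" "finite (carrier G2)"
    by (simp_all add: G2_def sym_group_is_group finite_sym_group)
  have reg: "regular_hypermap (G2, transpose 1 3, transpose 1 2, transpose 3 4)"
    using grp invol distinct(1) gen by simp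
  have reg': "regular_hypermap (G2, transpose 3 4, transpose 1 3, transpose 1 2)"
    using grp invol distinct(2) gen' by simp
  have type: "hypermap_type (G2, transpose 1 3, transpose 1 2, transpose 3 4) = (2, 3, 3)"
    and type': "hypermap_type (G2, transpose 3 4, transpose 1 3, transpose 1 2) = (3, 2, 3)"
    using ord by simp_all
  show "has_M_sequence (G2, transpose 1 3, transpose 1 2, transpose 3 4) (0, (2, 3, 3), (6, 4, 4), 24)"
    by (rule has_M_sequence_sphereI[where \<phi> = "\<lambda>p. \<not> evenperm p", OF reg type card hom]) (simp_all add: evenperm_swap)
  show "has_M_sequence (G2, transpose 3 4, transpose 1 3, transpose 1 2) (0, (3, 2, 3), (4, 6, 4), 24)"
    by (rule has_M_sequence_sphereI[where \<phi> = "\<lambda>p. \<not> evenperm p", OF reg' type' card hom]) (simp_all add: evenperm_swap)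
qed

section \<open>The presented group \<open>G\<^sub>4\<close>\<close>

lemma word_equiv_append:
  assumes "word_equiv R u v"
  shows "word_equiv R (a @ u @ b) (a @ v @ b)"
  using assms
proof induction
  case (cancel u x c v)
  show ?case
    using word_equiv.cancel[of R "a @ u" x c "v @ b"] by simp
next
  case (relator r u v)
  then show ?case
    using word_equiv.relator[of r R "a @ u" "v @ b"] by simp
next
  case (trans u v w)
  show ?case
    by (rule word_equiv.trans[OF trans.IH])
qed (simp_all add: word_equiv.refl word_equiv.sym)

lemma word_class_eq_iff: "word_class R u = word_class R v \<longleftrightarrow> word_equiv R u v"
proof
  show "word_equiv R u v" if "word_class R u = word_class R v"
    using that word_equiv.refl[of R v] unfolding word_class_def by blast
  show "word_class R u = word_class R v" if "word_equiv R u v"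
    unfolding word_class_def
    by (intro Collect_cong iffI)
      (erule word_equiv.trans[OF word_equiv.sym[OF that]], erule word_equiv.trans[OF that])
qed

lemma word_class_self: "u \<in> word_class R u"
  by (simp add: word_class_def word_equiv.refl)

lemma word_equiv_cong:
  assumes "word_equiv R u u'" "word_equiv R v v'"
  shows "word_equiv R (u @ v) (u' @ v')"
  using word_equiv.trans[OF word_equiv_append[OF assms(1), of "[]" v, simplified] word_equiv_append[OF assms(2), of u' "[]", simplified]]
  by simp

text \<open>The union in the definition runs over all pairs of representatives. By congruence every
  pair yields the same class, and the classes are nonempty, so the union is that class.\<close>

lemma presented_group_mult:
  "word_class R u \<otimes>\<^bsub>presented_group R\<^esub> word_class R v = word_class R (u @ v)"
proof -
  have "word_class R (u' @ v') = word_class R (u @ v)" if "u' \<in> word_class R u" "v' \<in> word_class R v" for u' v'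
    using that word_equiv_cong[of R u u' v v'] word_class_eq_iff[of R "u @ v" "u' @ v'"]
    by (simp add: word_class_def)
  then have "word_class R u \<otimes>\<^bsub>presented_group R\<^esub> word_class R v
      = (\<Union>u'\<in>word_class R u. \<Union>v'\<in>word_class R v. word_class R (u @ v))"
    by (simp add: presented_group_def)
  moreover have "word_class R u \<noteq> {}" "word_class R v \<noteq> {}"
    using word_class_self by blast+
  ultimately show ?thesis
    by simp
qed

lemma presented_group_carrier: "carrier (presented_group R) = range (word_class R)"
  by (simp add: presented_group_def)

lemma presented_group_one: "\<one>\<^bsub>presented_group R\<^esub> = word_class R []"
  by (simp add: presented_group_def)

lemma word_equiv_inverse: "word_equiv R (rev (map (\<lambda>(x, b). (x, \<not> b)) u) @ u) []"
proof (induction u)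
  case Nil
  then show ?case by (simp add: word_equiv.refl)
next
  case (Cons l u)
  obtain x b where l: "l = (x, b)" by fastforce
  have "word_equiv R (rev (map (\<lambda>(x, b). (x, \<not> b)) u) @ [(x, \<not> b), (x, \<not> \<not> b)] @ u)
      (rev (map (\<lambda>(x, b). (x, \<not> b)) u) @ u)"
    by (rule word_equiv.cancel)
  with Cons show ?case
    by (auto simp: l intro: word_equiv.trans)
qed

lemma group_presented_group: "group (presented_group R)"
proof (rule groupI)
  show "\<exists>y\<in>carrier (presented_group R). y \<otimes>\<^bsub>presented_group R\<^esub> x = \<one>\<^bsub>presented_group R\<^esub>"
    if "x \<in> carrier (presented_group R)" for x
  proof -
    from that obtain u where u: "x = word_class R u"
      by (auto simp: presented_group_carrier)
    let ?v = "rev (map (\<lambda>(x, b). (x, \<not> b)) u)"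
    have "word_class R ?v \<otimes>\<^bsub>presented_group R\<^esub> x = \<one>\<^bsub>presented_group R\<^esub>"
      by (simp add: u presented_group_mult presented_group_one word_class_eq_iff word_equiv_inverse)
    then show ?thesis
      by (auto simp: presented_group_carrier)
  qed
qed (auto simp: presented_group_carrier presented_group_mult presented_group_one)

lemma pow_presented_group:
  "word_class R u [^]\<^bsub>presented_group R\<^esub> (j::nat) = word_class R (concat (replicate j u))"
proof (induction j)
  case 0
  then show ?case
    by (simp add: nat_pow_def presented_group_one)
next
  case (Suc j)
  have "concat (replicate j u) @ u = u @ concat (replicate j u)"
    by (induction j) simp_all
  with Suc show ?case
    by (simp add: nat_pow_def presented_group_mult)
qed

section \<open>Evaluation of words and von Dyck's theorem\<close>

definition word_eval :: "('b, 'c) monoid_scheme \<Rightarrow> ('a \<Rightarrow> 'b) \<Rightarrow> 'a gword \<Rightarrow> 'b" where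
  "word_eval H f u = foldr (\<lambda>(x, b) y. (if b then f x else inv\<^bsub>H\<^esub> f x) \<otimes>\<^bsub>H\<^esub> y) u \<one>\<^bsub>H\<^esub>"

lemma word_eval_simps [simp]:
  "word_eval H f [] = \<one>\<^bsub>H\<^esub>"
  "word_eval H f ((x, b) # u) = (if b then f x else inv\<^bsub>H\<^esub> f x) \<otimes>\<^bsub>H\<^esub> word_eval H f u"
  by (simp_all add: word_eval_def)

lemma (in group) word_eval_closed [simp]: "(\<And>x. f x \<in> carrier G) \<Longrightarrow> word_eval G f u \<in> carrier G"
  by (induction u) auto

lemma (in group) word_eval_append:
  "(\<And>x. f x \<in> carrier G) \<Longrightarrow> word_eval G f (u @ v) = word_eval G f u \<otimes> word_eval G f v"
  by (induction u) (auto simp: m_assoc)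

lemma (in group) word_eval_concat_replicate:
  "(\<And>x. f x \<in> carrier G) \<Longrightarrow> word_eval G f (concat (replicate j u)) = word_eval G f u [^] (j::nat)"
proof (induction j)
  case (Suc j)
  then have "word_eval G f u [^] Suc j = word_eval G f u \<otimes> word_eval G f u [^] j"
    by (intro nat_pow_Suc2 word_eval_closed)
  with Suc show ?case
    by (simp add: word_eval_append)
qed simp

lemma (in group) word_eval_cong:
  assumes f: "\<And>x. f x \<in> carrier G" and R: "\<And>r. r \<in> R \<Longrightarrow> word_eval G f r = \<one>"
    and "word_equiv R u v"
  shows "word_eval G f u = word_eval G f v"
  using assms(3)
proof induction
  case (cancel u x b v)
  have "f x \<otimes> (inv (f x) \<otimes> y) = y" "inv (f x) \<otimes> (f x \<otimes> y) = y" if "y \<in> carrier G" for y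
    using f that by (simp_all flip: m_assoc)
  then show ?case
    using f by (simp add: word_eval_append)
next
  case (relator r u v)
  then show ?case
    using f R by (simp add: word_eval_append)
qed auto

text \<open>Von Dyck's theorem. The map sends a class to the single value that
  \<open>word_eval\<close> takes on it, which \<open>word_eval_cong\<close> shows to be well
  defined.\<close>

lemma (in group) presented_group_hom:
  assumes f: "\<And>x. f x \<in> carrier G" and R: "\<And>r. r \<in> R \<Longrightarrow> word_eval G f r = \<one>"
  obtains h where "h \<in> hom (presented_group R) G" "\<And>u. h (word_class R u) = word_eval G f u"
proof
  define h where "h = (\<lambda>A. the_elem (word_eval G f ` A))"
  show h: "h (word_class R u) = word_eval G f u" for u
  proof -
    have "word_eval G f v = word_eval G f u" if "v \<in> word_class R u" for v
      using that word_eval_cong[OF f R] by (simp add: word_class_def)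
    then have "word_eval G f ` word_class R u = {word_eval G f u}"
      using word_class_self[of u R] by blast
    then show ?thesis by (simp add: h_def)
  qed
  show "h \<in> hom (presented_group R) G"
    using f by (auto simp: hom_def presented_group_carrier presented_group_mult h word_eval_append)
qed

text \<open>Coset enumeration applied to right multiplications: the orbit of the identity contains
  the generated subgroup. This is what bounds the order of \<open>G4 n\<close> from above, before
  the group is known to be finite.\<close>

lemma (in group) card_generate_22n:
  assumes c: "a \<in> carrier G" "b \<in> carrier G" "c \<in> carrier G"
    and sq: "a \<otimes> a = \<one>" "b \<otimes> b = \<one>" "c \<otimes> c = \<one>"
    and rel: "(a \<otimes> b) [^] n = \<one>" "(b \<otimes> c) [^] (2::nat) = \<one>" "(a \<otimes> c) [^] (2::nat) = \<one>" and n: "n > 0"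
  shows "finite (generate G {a, b, c})" "card (generate G {a, b, c}) \<le> 4 * n"
proof -
  define act where "act u = (\<lambda>x. if x \<in> carrier G then x \<otimes> u else x)" for u
  have comp: "act u \<circ> act v = act (v \<otimes> u)" if "u \<in> carrier G" "v \<in> carrier G" for u v
    using that by (auto simp: act_def fun_eq_iff m_assoc)
  have one: "act \<one> = id"
    by (auto simp: act_def)
  have pow: "act u ^^ j = act (u [^] j)" if "u \<in> carrier G" for u and j :: nat
    using that by (induction j) (simp_all add: one comp)
  have sq': "act a \<circ> act a = id" "act b \<circ> act b = id" "act c \<circ> act c = id"
    using c sq by (simp_all add: comp one)
  \<comment> \<open>Right multiplication reverses the products;
    \<open>funpow_comp_swap_eq_id\<close> then restores the order expected by
    \<open>card_orbit_22n\<close>.\<close>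
  have "(act b \<circ> act a) ^^ n = id" "(act c \<circ> act b) ^^ 2 = id" "(act c \<circ> act a) ^^ 2 = id"
    using c rel by (simp_all only: comp pow one m_closed)
  then have rel': "(act a \<circ> act b) ^^ n = id" "(act b \<circ> act c) ^^ 2 = id" "(act a \<circ> act c) ^^ 2 = id"
    using funpow_comp_swap_eq_id[OF sq'(2)] funpow_comp_swap_eq_id[OF sq'(3)] by auto
  let ?Q = "flag_orbit {act a, act b, act c} \<one>"
  have Q: "finite ?Q" "card ?Q \<le> 4 * n"
    using card_orbit_22n[OF sq' rel' n] by auto
  have QG: "x \<in> carrier G" if "x \<in> ?Q" for x
    using that by induction (use c in \<open>auto simp: act_def\<close>)
  have "generate G {a, b, c} \<subseteq> ?Q"
  proof (rule generate_involutions_subset)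
    show "x \<otimes> s \<in> ?Q" if "x \<in> ?Q" "s \<in> {a, b, c}" for x s
    proof -
      have "act s x \<in> ?Q"
        by (rule flag_orbit.step[OF that(1)]) (use that(2) in auto)
      then show ?thesis
        using QG[OF that(1)] by (simp add: act_def)
    qed
  qed (use c sq QG flag_orbit.base in auto)
  then show "finite (generate G {a, b, c})" "card (generate G {a, b, c}) \<le> 4 * n"
    using Q(1) order_trans[OF card_mono[OF Q(1)] Q(2)] by (auto intro: finite_subset)
qed

section \<open>The dihedral model of the presented group\<close>

lemma group_dihedral_group:
  assumes "n > 0"
  shows "group (dihedral_group n)"
proof (rule groupI)
  have n: "int n > 0" using assms by simp
  show "x \<otimes>\<^bsub>dihedral_group n\<^esub> y \<in> carrier (dihedral_group n)" for x y
    using n by (auto simp: dihedral_group_def split: prod.splits)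
  show "\<one>\<^bsub>dihedral_group n\<^esub> \<in> carrier (dihedral_group n)"
    using n by (simp add: dihedral_group_def)
  show "x \<otimes>\<^bsub>dihedral_group n\<^esub> y \<otimes>\<^bsub>dihedral_group n\<^esub> z = x \<otimes>\<^bsub>dihedral_group n\<^esub> (y \<otimes>\<^bsub>dihedral_group n\<^esub> z)" for x y z
    by (auto simp: dihedral_group_def mod_simps algebra_simps split: prod.splits)
  show "\<one>\<^bsub>dihedral_group n\<^esub> \<otimes>\<^bsub>dihedral_group n\<^esub> x = x" if "x \<in> carrier (dihedral_group n)" for x
    using that by (auto simp: dihedral_group_def)
  show "\<exists>y\<in>carrier (dihedral_group n). y \<otimes>\<^bsub>dihedral_group n\<^esub> x = \<one>\<^bsub>dihedral_group n\<^esub>"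
    if "x \<in> carrier (dihedral_group n)" for x
  proof -
    obtain i s where x: "x = (i, s)" by fastforce
    have "(if s then i else - i mod int n, s) \<in> carrier (dihedral_group n)"
      using that n by (auto simp: dihedral_group_def x)
    moreover have "(if s then i else - i mod int n, s) \<otimes>\<^bsub>dihedral_group n\<^esub> x = \<one>\<^bsub>dihedral_group n\<^esub>"
      by (simp add: dihedral_group_def x mod_simps)
    ultimately show ?thesis by blast
  qed
qed

text \<open>The presentation alone gives at most \<open>4 * n\<close> elements, and a homomorphism
  onto the model \<open>D\<close> of that order gives at least as many. Hence the homomorphism is
  bijective, and orders and parity can be read off in \<open>D\<close>.\<close>

lemma G4_iso_and_M_sequence:
  assumes n: "n \<ge> 3"
  shows "G4 n \<cong> integer_mod_group 2 \<times>\<times> dihedral_group n"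
    and "has_M_sequence (G4_hypermap n) (0, (2, 2, n), (n, n, 2), 4 * n)"
proof -
  define R where "R = G4_relators n"
  have R: "R = {[(R0, True), (R0, True)], [(R1, True), (R1, True)], [(R2, True), (R2, True)],
      concat (replicate n [(R0, True), (R1, True)]), concat (replicate 2 [(R1, True), (R2, True)]),
      concat (replicate 2 [(R0, True), (R2, True)])}"
    by (simp add: R_def G4_relators_def Let_def)
  have G4: "G4 n = presented_group R"
    by (simp add: G4_def R_def)
  interpret G: group "presented_group R"
    by (rule group_presented_group)
  define D where "D = integer_mod_group 2 \<times>\<times> dihedral_group n"
  interpret D: group D
    unfolding D_def using n by (intro DirProd_group group_dihedral_group) auto
  have D_carrier: "carrier D = {0, 1} \<times> {0..<int n} \<times> UNIV"
    by (auto simp: D_def carrier_integer_mod_group dihedral_group_def)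
  have D_one: "\<one>\<^bsub>D\<^esub> = (0, 0, False)"
    by (simp add: D_def one_DirProd dihedral_group_def)
  have D_mult: "(a, i, s) \<otimes>\<^bsub>D\<^esub> (b, j, t) = ((a + b) mod 2, (if s then i - j else i + j) mod int n, s \<noteq> t)" for a i s b j t
    by (simp add: D_def dihedral_group_def)
  \<comment> \<open>\<open>R0\<close> and \<open>R1\<close> go to reflections whose product is the
    rotation by 1, and \<open>R2\<close> to the generator of the central factor.\<close>
  define f where "f = (\<lambda>x. case x of R0 \<Rightarrow> (0::int, 1::int, True) | R1 \<Rightarrow> (0, 0, True) | R2 \<Rightarrow> (1, 0, False))"
  have f [simp]: "f R0 = (0, 1, True)" "f R1 = (0, 0, True)" "f R2 = (1, 0, False)"
    by (simp_all add: f_def)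
  have f_range: "f x \<in> carrier D" for x
    using n by (cases x) (simp_all add: D_carrier)
  have rot: "(0, 1, False) [^]\<^bsub>D\<^esub> j = (0, int j mod int n, False)" for j :: nat
    by (induction j) (simp_all add: D_one D_mult mod_simps add.commute)
  have eval_rot: "word_eval D f (concat (replicate j [(R0, True), (R1, True)])) = (0, int j mod int n, False)" for j
    using n by (simp add: D.word_eval_concat_replicate[OF f_range] D_one D_mult rot)
  have eval_R: "word_eval D f r = \<one>\<^bsub>D\<^esub>" if "r \<in> R" for r
    using that n unfolding R
    by (elim insertE emptyE)
      (simp_all only: eval_rot, simp_all add: D_mult D_one numeral_2_eq_2)
  obtain h where hom: "h \<in> hom (presented_group R) D" and h: "\<And>u. h (word_class R u) = word_eval D f u"
    using D.presented_group_hom[OF f_range eval_R] by blast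
  let ?r = "\<lambda>x. word_class R [(x, True)]"
  have rel: "word_class R r = \<one>\<^bsub>presented_group R\<^esub>" if "r \<in> R" for r
    using word_equiv.relator[OF that, of "[]" "[]"] by (simp add: presented_group_one word_class_eq_iff)
  have sq: "?r x \<otimes>\<^bsub>presented_group R\<^esub> ?r x = \<one>\<^bsub>presented_group R\<^esub>" for x
    using rel[of "[(x, True), (x, True)]"] by (cases x) (simp_all add: R presented_group_mult)
  have powers: "(?r R0 \<otimes>\<^bsub>presented_group R\<^esub> ?r R1) [^]\<^bsub>presented_group R\<^esub> n = \<one>\<^bsub>presented_group R\<^esub>"
    "(?r R1 \<otimes>\<^bsub>presented_group R\<^esub> ?r R2) [^]\<^bsub>presented_group R\<^esub> (2::nat) = \<one>\<^bsub>presented_group R\<^esub>"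
    "(?r R0 \<otimes>\<^bsub>presented_group R\<^esub> ?r R2) [^]\<^bsub>presented_group R\<^esub> (2::nat) = \<one>\<^bsub>presented_group R\<^esub>"
    unfolding presented_group_mult pow_presented_group by (rule rel; simp add: R)+
  have r_carrier: "?r x \<in> carrier (presented_group R)" for x
    by (simp add: presented_group_carrier)
  let ?S = "{?r R0, ?r R1, ?r R2}"
  have inverse_letter: "word_class R [(x, False)] = ?r x" for x
  proof -
    have "word_class R [(x, False)] \<otimes>\<^bsub>presented_group R\<^esub> ?r x = \<one>\<^bsub>presented_group R\<^esub>"
      using word_equiv.cancel[of R "[]" x False "[]"]
      by (simp add: presented_group_mult presented_group_one word_class_eq_iff)
    moreover have "word_class R [(x, False)] \<in> carrier (presented_group R)"
      by (simp add: presented_group_carrier)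
    ultimately show ?thesis
      using sq[of x] r_carrier by (metis G.r_cancel)
  qed
  have gen: "generate (presented_group R) ?S = carrier (presented_group R)"
  proof
    show "generate (presented_group R) ?S \<subseteq> carrier (presented_group R)"
      using r_carrier by (intro G.generate_incl) auto
    have "word_class R u \<in> generate (presented_group R) ?S" for u
    proof (induction u)
      case Nil
      then show ?case
        using generate.one[of "presented_group R" ?S] by (simp add: presented_group_one)
    next
      case (Cons l u)
      obtain x b where l: "l = (x, b)" by fastforce
      have "word_class R [l] = ?r x"
        using inverse_letter by (cases b) (simp_all add: l)
      moreover have "?r x \<in> ?S"
        by (cases x) auto
      ultimately have "word_class R [l] \<in> generate (presented_group R) ?S"
        by (auto intro: generate.incl)
      then have "word_class R [l] \<otimes>\<^bsub>presented_group R\<^esub> word_class R u \<in> generate (presented_group R) ?S"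
        using Cons by (rule generate.eng)
      then show ?case
        by (simp add: presented_group_mult)
    qed
    then show "carrier (presented_group R) \<subseteq> generate (presented_group R) ?S"
      by (auto simp: presented_group_carrier)
  qed
  have fin: "finite (carrier (presented_group R))" and le: "card (carrier (presented_group R)) \<le> 4 * n"
    using G.card_generate_22n[OF r_carrier r_carrier r_carrier sq sq sq powers] n unfolding gen by auto
  have cardD: "card (carrier D) = 4 * n"
    by (simp add: D_carrier card_cartesian_product UNIV_bool)
  have surj: "h ` carrier (presented_group R) = carrier D"
  proof
    show "h ` carrier (presented_group R) \<subseteq> carrier D"
      using hom by (auto simp: hom_def)
    show "carrier D \<subseteq> h ` carrier (presented_group R)"
    proof
      fix z assume "z \<in> carrier D"
      then obtain a i s where z: "z = (a, i, s)" "a = 0 \<or> a = 1" "0 \<le> i" "i < int n"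
        by (auto simp: D_carrier)
      \<comment> \<open>The normal form: a power of \<open>r0 r1\<close>, then possibly
        \<open>r1\<close>, then possibly \<open>r2\<close>.\<close>
      let ?u = "concat (replicate (nat i) [(R0, True), (R1, True)]) @ (if s then [(R1, True)] else [])
        @ (if a = 1 then [(R2, True)] else [])"
      have "h (word_class R ?u) = z"
        using z n by (auto simp: h D.word_eval_append[OF f_range] eval_rot D_one D_mult)
      then show "z \<in> h ` carrier (presented_group R)"
        by (auto simp: presented_group_carrier)
    qed
  qed
  then have card: "card (carrier (presented_group R)) = 4 * n"
    using le card_image_le[OF fin, of h] cardD by simp
  then have "inj_on h (carrier (presented_group R))"
    using fin surj cardD by (intro eq_card_imp_inj_on) simp_all
  then have "h \<in> iso (presented_group R) D"
    using hom surj by (simp add: iso_def bij_betw_def)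
  then show "G4 n \<cong> integer_mod_group 2 \<times>\<times> dihedral_group n"
    by (auto simp: is_iso_def G4 D_def)
  have h_r: "h (?r R0) = (0, 1, True)" "h (?r R1) = (0, 0, True)" "h (?r R2) = (1, 0, False)"
    using n by (simp_all add: h D_one D_mult)
  have h_one: "h \<one>\<^bsub>presented_group R\<^esub> = (0, 0, False)"
    by (simp add: h presented_group_one D_one)
  have hmult: "h (x \<otimes>\<^bsub>presented_group R\<^esub> y) = h x \<otimes>\<^bsub>D\<^esub> h y"
    if "x \<in> carrier (presented_group R)" "y \<in> carrier (presented_group R)" for x y
    using hom that by (auto simp: hom_def)
  have r_ne_one: "?r x \<noteq> \<one>\<^bsub>presented_group R\<^esub>" for x
    by (cases x) (metis h_one h_r Pair_inject zero_neq_one)+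
  have distinct: "distinct [?r R0, ?r R1, ?r R2]"
    using h_r by (auto dest: arg_cong[of _ _ h])
  have invol: "involution (presented_group R) (?r x)" for x
    using r_carrier r_ne_one sq by (simp add: involution_def)
  have reg: "regular_hypermap (presented_group R, ?r R0, ?r R1, ?r R2)"
    using fin G.group_axioms invol distinct gen by simp
  have "?r R1 \<otimes>\<^bsub>presented_group R\<^esub> ?r R2 \<noteq> \<one>\<^bsub>presented_group R\<^esub>" "?r R0 \<otimes>\<^bsub>presented_group R\<^esub> ?r R2 \<noteq> \<one>\<^bsub>presented_group R\<^esub>"
    using distinct sq r_carrier by (metis G.r_cancel distinct_length_2_or_more)+
  have ord2: "G.ord x = 2" if x: "x \<in> carrier (presented_group R)" "x \<noteq> \<one>\<^bsub>presented_group R\<^esub>"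
      "x [^]\<^bsub>presented_group R\<^esub> (2::nat) = \<one>\<^bsub>presented_group R\<^esub>" for x
  proof -
    have "G.ord x dvd 2" using x by (simp add: G.pow_eq_id)
    then have "G.ord x = 1 \<or> G.ord x = 2"
      using prime_nat_iff two_is_prime_nat by blast
    then show ?thesis using G.ord_eq_1 x by blast
  qed
  have "G.ord (?r R1 \<otimes>\<^bsub>presented_group R\<^esub> ?r R2) = 2" "G.ord (?r R0 \<otimes>\<^bsub>presented_group R\<^esub> ?r R2) = 2"
    using \<open>?r R1 \<otimes>\<^bsub>presented_group R\<^esub> ?r R2 \<noteq> _\<close> \<open>?r R0 \<otimes>\<^bsub>presented_group R\<^esub> ?r R2 \<noteq> _\<close> powers r_carrier
    by (auto intro: ord2)
  moreover have "G.ord (?r R0 \<otimes>\<^bsub>presented_group R\<^esub> ?r R1) = n"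
  \<comment> \<open>The relator bounds the order from above; the image under \<open>h\<close>, a
    rotation of order \<open>n\<close>, bounds it from below.\<close>
  proof (rule dvd_antisym)
    let ?x = "?r R0 \<otimes>\<^bsub>presented_group R\<^esub> ?r R1"
    show "G.ord ?x dvd n"
      using powers(1) r_carrier by (simp add: G.pow_eq_id)
    let ?j = "G.ord ?x"
    have "?x [^]\<^bsub>presented_group R\<^esub> ?j = \<one>\<^bsub>presented_group R\<^esub>"
      using r_carrier by simp
    then have "h (word_class R (concat (replicate ?j [(R0, True), (R1, True)]))) = h \<one>\<^bsub>presented_group R\<^esub>"
      unfolding presented_group_mult pow_presented_group by simp
    then have "int ?j mod int n = 0"
      by (simp add: h eval_rot h_one)
    then show "n dvd ?j"
      by presburger
  qed
  ultimately have type: "hypermap_type (presented_group R, ?r R0, ?r R1, ?r R2) = (2, 2, n)"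
    by simp
  \<comment> \<open>The central coordinate added to the reflection flag: \<open>r0\<close> and
    \<open>r1\<close> are odd through the flag, \<open>r2\<close> through the coordinate.\<close>
  let ?\<phi> = "\<lambda>x. case h x of (a, _, s) \<Rightarrow> (a = 1) \<noteq> s"
  have "has_M_sequence (presented_group R, ?r R0, ?r R1, ?r R2) (0, (2, 2, n), (n, n, 2), 4 * n)"
  proof (rule has_M_sequence_sphereI[where \<phi> = ?\<phi>, OF reg type card])
    fix x y assume xy: "x \<in> carrier (presented_group R)" "y \<in> carrier (presented_group R)"
    then have "h x \<in> carrier D" "h y \<in> carrier D"
      using hom by (auto simp: hom_def)
    then show "?\<phi> (x \<otimes>\<^bsub>presented_group R\<^esub> y) \<longleftrightarrow> ?\<phi> x \<noteq> ?\<phi> y"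
      unfolding hmult[OF xy] by (auto simp: D_carrier D_mult)
  qed (simp_all add: h_r)
  then show "has_M_sequence (G4_hypermap n) (0, (2, 2, n), (n, n, 2), 4 * n)"
    by (simp add: G4_hypermap_def Let_def presented_gen_def G4 flip: R_def)
qed

section \<open>The classification\<close>

theorem theorem4p13:
  fixes G :: "'a monoid" and r0 r1 r2 :: 'a
  assumes "regular_linear_hypermap (G, r0, r1, r2)"
    and "on_sphere (G, r0, r1, r2)"
  shows
    "(hypermap_iso (G, r0, r1, r2)
         (G1, (transpose 1 2 \<circ> transpose 3 5, 1), (transpose 1 2 \<circ> transpose 3 4, 1), (transpose 1 3 \<circ> transpose 2 4, 1)) \<or>
      hypermap_iso (G, r0, r1, r2)
         (G1, (transpose 1 2 \<circ> transpose 3 5, 1), (transpose 1 3 \<circ> transpose 2 4, 1), (transpose 1 2 \<circ> transpose 3 4, 1)) \<or>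
      hypermap_iso (G, r0, r1, r2)
         (G1, (transpose 1 4 \<circ> transpose 3 5, 1), (transpose 1 2 \<circ> transpose 4 5, 1), (transpose 1 3 \<circ> transpose 4 5, 1)) \<or>
      hypermap_iso (G, r0, r1, r2)
         (G1, (transpose 1 4 \<circ> transpose 3 5, 1), (transpose 1 4 \<circ> transpose 2 3, 1), (transpose 1 3 \<circ> transpose 4 5, 1)) \<or>
      hypermap_iso (G, r0, r1, r2)
         (G2, transpose 1 3, transpose 1 2, transpose 3 4) \<or>
      hypermap_iso (G, r0, r1, r2)
         (G2, transpose 3 4, transpose 1 3, transpose 1 2) \<or>
      hypermap_iso (G, r0, r1, r2)
         (G3, (transpose 1 3, 0), (transpose 3 4, 0), (transpose 1 2 \<circ> transpose 3 4, 1)) \<or>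
      hypermap_iso (G, r0, r1, r2)
         (G3, (transpose 1 3, 0), (transpose 1 2 \<circ> transpose 3 4, 1), (transpose 3 4, 0)) \<or>
      hypermap_iso (G, r0, r1, r2)
         (G3, (transpose 1 2 \<circ> transpose 3 4, 1), (transpose 1 3, 0), (transpose 1 2, 0)) \<or>
      hypermap_iso (G, r0, r1, r2)
         (G3, (transpose 1 3, 1), (transpose 1 2, 1), (transpose 1 3 \<circ> transpose 2 4, 1)) \<or>
      (\<exists>n \<ge> 3. hypermap_iso (G, r0, r1, r2) (G4_hypermap n)))
     \<and>
     (has_M_sequence
         (G1, (transpose 1 2 \<circ> transpose 3 5, 1), (transpose 1 2 \<circ> transpose 3 4, 1), (transpose 1 3 \<circ> transpose 2 4, 1))
         (0, (2, 5, 3), (30, 12, 20), 120) \<and>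
      has_M_sequence
         (G1, (transpose 1 2 \<circ> transpose 3 5, 1), (transpose 1 3 \<circ> transpose 2 4, 1), (transpose 1 2 \<circ> transpose 3 4, 1))
         (0, (2, 3, 5), (30, 20, 12), 120) \<and>
      has_M_sequence
         (G1, (transpose 1 4 \<circ> transpose 3 5, 1), (transpose 1 2 \<circ> transpose 4 5, 1), (transpose 1 3 \<circ> transpose 4 5, 1))
         (0, (3, 2, 5), (20, 30, 12), 120) \<and>
      has_M_sequence
         (G1, (transpose 1 4 \<circ> transpose 3 5, 1), (transpose 1 4 \<circ> transpose 2 3, 1), (transpose 1 3 \<circ> transpose 4 5, 1))
         (0, (5, 2, 3), (12, 30, 20), 120) \<and>
      has_M_sequence
         (G2, transpose 1 3, transpose 1 2, transpose 3 4)
         (0, (2, 3, 3), (6, 4, 4), 24) \<and>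
      has_M_sequence
         (G2, transpose 3 4, transpose 1 3, transpose 1 2)
         (0, (3, 2, 3), (4, 6, 4), 24) \<and>
      has_M_sequence
         (G3, (transpose 1 3, 0), (transpose 3 4, 0), (transpose 1 2 \<circ> transpose 3 4, 1))
         (0, (2, 4, 3), (12, 6, 8), 48) \<and>
      has_M_sequence
         (G3, (transpose 1 3, 0), (transpose 1 2 \<circ> transpose 3 4, 1), (transpose 3 4, 0))
         (0, (2, 3, 4), (12, 8, 6), 48) \<and>
      has_M_sequence
         (G3, (transpose 1 2 \<circ> transpose 3 4, 1), (transpose 1 3, 0), (transpose 1 2, 0))
         (0, (3, 2, 4), (8, 12, 6), 48) \<and>
      has_M_sequence
         (G3, (transpose 1 3, 1), (transpose 1 2, 1), (transpose 1 3 \<circ> transpose 2 4, 1))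
         (0, (4, 2, 3), (6, 12, 8), 48) \<and>
      (\<forall>n \<ge> 3. G4 n \<cong> integer_mod_group 2 \<times>\<times> dihedral_group n \<and>
         has_M_sequence (G4_hypermap n) (0, (2, 2, n), (n, n, 2), 4 * n)))"
    (is "?iso \<and> ?seq")
proof
  let ?M = "(G, r0, r1, r2)"
  have reg: "regular_hypermap ?M"
    using assms(1) by simp
  obtain k m n where type: "hypermap_type ?M = (k, m, n)"
    using prod_cases3 by blast
  define N where "N = card (carrier G)"
  have grp: "group G" "finite (carrier G)" and inv: "involution G r0" "involution G r1" "involution G r2"
    and ne: "r0 \<noteq> r1" "r0 \<noteq> r2" "r1 \<noteq> r2"
    using reg by auto
  have "k \<ge> 2" "m \<ge> 2" "n \<ge> 3"
    using type linear_hypermap_face_order[OF assms(1)] involution_product_order_ge_2[OF grp] inv ne by auto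
  then have "spherical_type k m n N"
    using spherical_typeI on_sphere_card[OF reg assms(2) type] unfolding N_def by blast
  \<comment> \<open>For each type it now suffices to name one model; its sequence supplies the type
    and the number of flags at once.\<close>
  note iso = spherical_hypermap_iso[OF reg type N_def[symmetric] _ this]
  from \<open>spherical_type k m n N\<close> show ?iso
  proof cases
    case 1
    show ?thesis
      using iso[unfolded 1, OF has_M_sequences_G1(1)] by blast
  next
    case 2
    show ?thesis
      using iso[unfolded 2, OF has_M_sequences_G1(2)] by blast
  next
    case 3
    show ?thesis
      using iso[unfolded 3, OF has_M_sequences_G1(3)] by blast
  next
    case 4
    show ?thesis
      using iso[unfolded 4, OF has_M_sequences_G1(4)] by blast
  next
    case 5
    show ?thesis
      using iso[unfolded 5, OF has_M_sequences_G2(1)] by blast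
  next
    case 6
    show ?thesis
      using iso[unfolded 6, OF has_M_sequences_G2(2)] by blast
  next
    case 7
    show ?thesis
      using iso[unfolded 7, OF has_M_sequences_G3(1)] by blast
  next
    case 8
    show ?thesis
      using iso[unfolded 8, OF has_M_sequences_G3(2)] by blast
  next
    case 9
    show ?thesis
      using iso[unfolded 9, OF has_M_sequences_G3(3)] by blast
  next
    case 10
    show ?thesis
      using iso[unfolded 10, OF has_M_sequences_G3'] by blast
  next
    case 11
    obtain s0 s1 s2 where M4: "G4_hypermap n = (G4 n, s0, s1, s2)"
      by (simp add: G4_hypermap_def Let_def)
    have "hypermap_iso ?M (G4_hypermap n)"
      using iso[unfolded 11(1-3), OF G4_iso_and_M_sequence(2)[OF 11(4), unfolded M4]] unfolding M4 .
    with 11 show ?thesis by blast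
  qed
  show ?seq
    using has_M_sequences_G1 has_M_sequences_G2 has_M_sequences_G3 has_M_sequences_G3' G4_iso_and_M_sequence by blast
qed

end
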